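(* Let $V(x)=\|x\|^\delta$ on $\mathbb R^d$ with $0<\delta<d$, and let the weights satisfy $\theta_j>0$ for all $j$ and $\lim_{j\to\infty}\frac1j\log\theta_j=0$. Assume that $\rho>\rho_{\rm c}$ and $\sum_{j\ge1}j\,\theta_j/j^{d/\delta}<\infty$. In addition, assume that there exist $C,c>0$, $a<\min\bigl(\frac12,1-\frac\delta d\bigr)$ and $b>a+\max\bigl(\frac12,\frac\delta d\bigr)$ such that for all $n$, $$C^{-1}e^{-cn^a}\le h_n\le C\,e^{cn^a},$$ and $$\lim_{n\to\infty}\ \max_{m\in[-n^b,n^b]}\frac{h_{n+m}}{h_n}=1.$$ Then, as $L,n\to\infty$ with $n=\rho L^d$, under $\mathbb P_{L,n}$, $$\frac{H_0-L^d(\rho-\rho_{\rm c}^L)}{\sigma_{\rm c}L^{d/2}}\longrightarrow\mathcal N(0,1)\quad\text{in distribution}.$$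
   Context: A spatial partition of $n$ is a family $\boldsymbol\lambda=(\lambda_x)_{x\in\mathbb Z^d}$ of integer partitions (possibly empty) whose parts sum in total to $n$; $\Lambda_n$ is the set of these. $r_{xj}(\boldsymbol\lambda)$ is the number of parts of $\lambda_x$ equal to $j$; $H_x=\sum_jj\,r_{xj}$, so $H_0$ is the occupation of the origin. The probability measure on $\Lambda_n$ is $$\mathbb P_{L,n}(\boldsymbol\lambda)=\frac1{Z_{L,n}}\prod_{x\in\mathbb Z^d}\prod_{j\ge1}\frac1{r_{xj}(\boldsymbol\lambda)!}\Bigl(\frac{\theta_j}{j}e^{-jV(x/L)}\Bigr)^{r_{xj}(\boldsymbol\lambda)},$$ with $Z_{L,n}$ the normalization. The numbers $h_m$ are given by $\sum_{m\ge0}h_mz^m=\exp\bigl(\sum_{j\ge1}\frac{\theta_j}{j}z^j\bigr)$ (formal power series), with $h_m=0$ for $m<0$; $m$ ranges over integers in the maximum. Further $$\rho_{\rm c}=\sum_{j\ge1}\theta_j\int_{\mathbb R^d}e^{-jV(x)}dx,\quad\rho_{\rm c}^L=\frac1{L^d}\sum_{j\ge1}\sum_{x\in\mathbb Z^d\setminus\{0\}}\theta_je^{-jV(x/L)},\quad\sigma_{\rm c}^2=\sum_{j\ge1}j\,\theta_j\int_{\mathbb R^d}e^{-jV(x)}dx.$$ $\|\cdot\|$ is the Euclidean norm and $\mathcal N(0,1)$ the standard normal law.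
   Formalization: The exponent a is additionally required to be nonnegative; with negative a allowed, the ratio condition can become vacuous (b negative) and the claim fails for bounded h_n with sharp steps. *)

theory Defs
  imports "HOL-Probability.Probability" "HOL-Computational_Algebra.Computational_Algebra"
    "HOL-Library.Multiset"
begin

text \<open>
  The lattice \<open>\<int>\<^sup>d\<close> is the type \<^typ>\<open>int ^ 'd\<close>, with \<open>d = CARD('d) \<ge> 1\<close>, and an integer partition
  is the multiset of its parts. The weights \<open>\<theta>\<^sub>j\<close> are used for \<open>j \<ge> 1\<close> only; \<open>\<theta> 0\<close> is irrelevant.
\<close>

definition lattice_point :: "int ^ 'd \<Rightarrow> real ^ 'd" where
  "lattice_point x = (\<chi> i. of_int (x $ i))"

definition integer_partition :: "nat multiset \<Rightarrow> bool" where
  "integer_partition p \<longleftrightarrow> (\<forall>j \<in># p. 1 \<le> j)"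

text \<open>The total is finite exactly when only finitely many of the partitions are nonempty.\<close>

definition spatial_partitions :: "nat \<Rightarrow> (int ^ 'd \<Rightarrow> nat multiset) set" where
  "spatial_partitions n =
     {l. (\<forall>x. integer_partition (l x)) \<and> finite {x. l x \<noteq> {#}} \<and>
         (\<Sum>x | l x \<noteq> {#}. sum_mset (l x)) = n}"

definition multiplicity_of :: "(int ^ 'd \<Rightarrow> nat multiset) \<Rightarrow> int ^ 'd \<Rightarrow> nat \<Rightarrow> nat" where
  "multiplicity_of l x j = count (l x) j"

definition occupation :: "(int ^ 'd \<Rightarrow> nat multiset) \<Rightarrow> int ^ 'd \<Rightarrow> nat" where
  "occupation l x = (\<Sum>j \<in> set_mset (l x). j * multiplicity_of l x j)"

text \<open>
  The product over all \<open>x\<close> and \<open>j \<ge> 1\<close> is restricted to the pairs with \<open>r\<^sub>x\<^sub>j \<noteq> 0\<close>; all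
  other factors are 1.
\<close>

definition weight ::
  "(real ^ 'd \<Rightarrow> real) \<Rightarrow> (nat \<Rightarrow> real) \<Rightarrow> real \<Rightarrow> (int ^ 'd \<Rightarrow> nat multiset) \<Rightarrow> real" where
  "weight V \<theta> L l =
     (\<Prod>x | l x \<noteq> {#}. \<Prod>j \<in> set_mset (l x).
        1 / fact (multiplicity_of l x j) *
        (\<theta> j / real j * exp (- real j * V (lattice_point x /\<^sub>R L))) ^ multiplicity_of l x j)"

definition partition_function :: "(real ^ 'd \<Rightarrow> real) \<Rightarrow> (nat \<Rightarrow> real) \<Rightarrow> real \<Rightarrow> nat \<Rightarrow> real" where
  "partition_function V \<theta> L n = (\<Sum>\<^sub>\<infinity>l \<in> spatial_partitions n. weight V \<theta> L l)"

definition partition_measure ::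
  "(real ^ 'd \<Rightarrow> real) \<Rightarrow> (nat \<Rightarrow> real) \<Rightarrow> real \<Rightarrow> nat \<Rightarrow> (int ^ 'd \<Rightarrow> nat multiset) measure" where
  "partition_measure V \<theta> L n =
     point_measure (spatial_partitions n)
       (\<lambda>l. ennreal (weight V \<theta> L l / partition_function V \<theta> L n))"

definition h_coeff :: "(nat \<Rightarrow> real) \<Rightarrow> int \<Rightarrow> real" where
  "h_coeff \<theta> m =
     (if m < 0 then 0
      else fps_nth (fps_exp 1 oo Abs_fps (\<lambda>j. if j = 0 then 0 else \<theta> j / real j)) (nat m))"

definition rho_c :: "(real ^ 'd \<Rightarrow> real) \<Rightarrow> (nat \<Rightarrow> real) \<Rightarrow> real" where
  "rho_c V \<theta> = (\<Sum>\<^sub>\<infinity>j \<in> {1..}. \<theta> j * (\<integral>x. exp (- real j * V x) \<partial>lborel))"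

definition rho_c_L :: "(real ^ 'd \<Rightarrow> real) \<Rightarrow> (nat \<Rightarrow> real) \<Rightarrow> real \<Rightarrow> real" where
  "rho_c_L V \<theta> L =
     1 / L ^ CARD('d) *
     (\<Sum>\<^sub>\<infinity>j \<in> {1..}. \<Sum>\<^sub>\<infinity>x \<in> - {0}. \<theta> j * exp (- real j * V (lattice_point x /\<^sub>R L)))"

definition sigma_c_sq :: "(real ^ 'd \<Rightarrow> real) \<Rightarrow> (nat \<Rightarrow> real) \<Rightarrow> real" where
  "sigma_c_sq V \<theta> =
     (\<Sum>\<^sub>\<infinity>j \<in> {1..}. real j * \<theta> j * (\<integral>x. exp (- real j * V x) \<partial>lborel))"

end

theory Submission
  imports Defs "HOL-Real_Asymp.Real_Asymp"
begin

text \<open>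
  Why the theorem holds. The potential vanishes at the origin, so the partition sitting there
  contributes to the weight only through its total, and summing over all partitions of \<open>m\<close> gives
  \<open>h m\<close>. The partitions at the other sites behave like independent Poisson variables: the number
  of parts \<open>j\<close> at \<open>x\<close> has parameter \<open>\<theta> j / j * exp (- j * V (x / L))\<close>. Hence the total \<open>K\<close> of the
  parts away from the origin is compound Poisson, with parameter \<open>\<phi> j / j\<close> for jumps of size \<open>j\<close>,
  where \<open>\<phi> j = \<theta> j * (\<Sum>x\<noteq>0. exp (- j * V (x / L)))\<close>, and the occupation of the origin is \<open>n - K\<close>
  where \<open>K\<close> has its law tilted by the density \<open>h (n - K)\<close>. Both the origin factor and the
  factor of the other sites are instances of one identity, \<open>weight_has_sum\<close>: partitions
  supported on \<open>X\<close> with total \<open>k\<close> have total weight \<open>h_coeff (\<lambda>j. \<theta> j * (\<Sum>x\<in>X. exp (- j * V (x / L)))) k\<close>.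
  It is proved by removing a part, which is the recurrence \<open>h_coeff_recurrence\<close>.

  The mean of \<open>K\<close> is \<open>\<Sum>j. \<phi> j = L ^ d * rho_c_L\<close>, and its variance is \<open>\<Sum>j. j * \<phi> j\<close>, which is
  asymptotic to \<open>sigma_c_sq * L ^ d\<close>: with \<open>r = L * j powr (- 1 / \<delta>)\<close> the sum over \<open>x \<noteq> 0\<close> is a
  Riemann sum of mesh \<open>1 / r\<close> for \<open>\<integral>exp (- norm y powr \<delta>) dy\<close>, uniformly bounded after
  normalization (\<open>lattice_sum\<close>, \<open>cell_profile_integral_tendsto\<close>). Expanding the exponent of the
  characteristic function of \<open>K\<close> to second order gives a central limit theorem for \<open>K\<close>
  (\<open>compound_poisson_clt\<close>).

  It remains to see that tilting changes nothing in the limit (\<open>tilt_negligible\<close>). Since \<open>\<rho>\<close>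
  exceeds the critical density, \<open>n - K\<close> is of order \<open>n\<close> at the mean of \<open>K\<close>. Within a window of
  width about \<open>n powr b\<close> the function \<open>h\<close> is asymptotically constant. Outside it \<open>h\<close> varies by at
  most a factor of order \<open>exp (2 * c * n powr a)\<close>, while \<open>K\<close> has exponential moments up to the lowest
  energy \<open>L powr (- \<delta>)\<close> of a site other than the origin, so that a Chernoff bound makes the
  probability of leaving the window at most
  \<open>exp (- const * n powr (b - max (1/2) (\<delta> / d)))\<close>. The assumption on \<open>b\<close> says that the second
  exponent wins.
\<close>

section \<open>The coefficients of an exponential power series\<close>

text \<open>
  The convention \<open>x / 0 = 0\<close> makes the constant coefficient vanish, as composition with the
  exponential series requires.
\<close>
definition part_fps :: "(nat \<Rightarrow> real) \<Rightarrow> real fps" where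
  "part_fps \<phi> = Abs_fps (\<lambda>j. \<phi> j / real j)"

lemma h_coeff_eq: "h_coeff \<phi> (int k) = (fps_exp 1 oo part_fps \<phi>) $ k"
proof -
  have "Abs_fps (\<lambda>j. if j = 0 then 0 else \<phi> j / real j) = part_fps \<phi>"
    by (rule fps_ext) (simp add: part_fps_def)
  then show ?thesis by (simp add: h_coeff_def)
qed

lemma h_coeff_neg [simp]: "m < 0 \<Longrightarrow> h_coeff \<phi> m = 0"
  by (simp add: h_coeff_def)

lemma h_coeff_0 [simp]: "h_coeff \<phi> 0 = 1"
  using h_coeff_eq[of \<phi> 0] by (simp add: fps_compose_nth)

lemma h_coeff_expand:
  "h_coeff \<phi> (int k) = (\<Sum>i\<le>k. (part_fps \<phi> ^ i) $ k / fact i)"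
  unfolding h_coeff_eq by (simp add: fps_compose_nth atLeast0AtMost)

text \<open>
  Compare coefficients in \<open>H' = H * A'\<close> for \<open>H = exp A\<close>, where \<open>A\<close> is \<open>part_fps \<phi>\<close>. Together with \<open>h_coeff_0\<close> this determines the
  coefficients, and sums over spatial partitions satisfy the same recurrence.
\<close>
lemma h_coeff_recurrence:
  assumes "0 < k"
  shows "real k * h_coeff \<phi> (int k) = (\<Sum>j=1..k. \<phi> j * h_coeff \<phi> (int (k - j)))"
proof -
  let ?H = "fps_exp (1::real) oo part_fps \<phi>"
  obtain n where n: "k = Suc n" using assms by (cases k) auto
  have "fps_deriv ?H = ?H * fps_deriv (part_fps \<phi>)"
    by (subst fps_compose_deriv) (auto simp: part_fps_def)
  then have "fps_deriv ?H $ n = (fps_deriv (part_fps \<phi>) * ?H) $ n"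
    by (simp add: mult.commute)
  also have "\<dots> = (\<Sum>i=0..n. \<phi> (Suc i) * ?H $ (n - i))"
    by (simp add: fps_mult_nth part_fps_def)
  also have "\<dots> = (\<Sum>j=1..k. \<phi> j * ?H $ (k - j))"
    unfolding n One_nat_def
    by (subst sum.atLeast_Suc_atMost_Suc_shift) simp
  finally show ?thesis
    unfolding h_coeff_eq by (simp add: n algebra_simps)
qed

lemma h_coeff_nonneg:
  assumes "\<And>j. 1 \<le> j \<Longrightarrow> 0 \<le> \<phi> j"
  shows "0 \<le> h_coeff \<phi> m"
proof (cases "m < 0")
  case False
  have "0 \<le> h_coeff \<phi> (int k)" for k
  proof (induction k rule: less_induct)
    case (less k)
    show ?case
    proof (cases "k = 0")
      case False
      have "0 \<le> real k * h_coeff \<phi> (int k)"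
        using False less.IH assms by (subst h_coeff_recurrence) (auto intro!: sum_nonneg mult_nonneg_nonneg simp del: of_nat_diff)
      then show ?thesis using False by (simp add: zero_le_mult_iff)
    qed auto
  qed
  from this[of "nat m"] False show ?thesis by simp
qed auto

lemma part_fps_power_nonneg:
  assumes "\<And>j. 1 \<le> j \<Longrightarrow> 0 \<le> \<phi> j"
  shows "0 \<le> (part_fps \<phi> ^ i) $ k"
proof (induction i arbitrary: k)
  case (Suc i)
  have "0 \<le> part_fps \<phi> $ j" for j
    using assms by (cases j) (auto simp: part_fps_def)
  then show ?case using Suc by (auto simp: fps_mult_nth intro!: sum_nonneg)
qed (auto simp: fps_one_nth)

text \<open>
  Powers of a series with nonnegative coefficients, evaluated by iterated Cauchy products; keeping
  track of absolute convergence allows the summations over \<open>i\<close> and \<open>k\<close> to be exchanged below.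
\<close>
lemma part_fps_power_sums:
  fixes z :: "'a :: {banach, real_normed_field}"
  assumes "\<And>j. 1 \<le> j \<Longrightarrow> 0 \<le> \<phi> j" and sm: "summable (\<lambda>j. \<phi> j / real j * norm z ^ j)"
  shows "summable (\<lambda>k. (part_fps \<phi> ^ i) $ k * norm z ^ k)"
    and "(\<lambda>k. of_real ((part_fps \<phi> ^ i) $ k) * z ^ k) sums ((\<Sum>j. of_real (\<phi> j / real j) * z ^ j) ^ i)"
proof -
  define A where "A = (\<lambda>k. of_real (part_fps \<phi> $ k) * z ^ k)"
  have nn: "0 \<le> part_fps \<phi> $ j" for j
    using assms by (cases j) (auto simp: part_fps_def)
  have A: "summable (\<lambda>k. norm (A k))"
    using sm nn by (simp add: A_def norm_mult norm_power part_fps_def del: times_divide_eq_left of_real_divide abs_divide)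
  have sA: "suminf A = (\<Sum>j. of_real (\<phi> j / real j) * z ^ j)"
    by (simp add: A_def part_fps_def)
  have "summable (\<lambda>k. norm (of_real ((part_fps \<phi> ^ i) $ k) * z ^ k)) \<and>
     (\<lambda>k. of_real ((part_fps \<phi> ^ i) $ k) * z ^ k) sums (suminf A ^ i)"
  proof (induction i)
    case 0
    have "(\<lambda>k. of_real ((1 :: real fps) $ k) * z ^ k) = (\<lambda>k. if k = 0 then 1 else 0)"
      by (auto simp: fps_one_nth)
    then show ?case using sums_single[of 0 "\<lambda>_. 1 :: 'a"]
      by (auto intro!: summable_finite[of "{0}"] split: if_splits)
  next
    case (Suc i)
    define B where "B = (\<lambda>k. of_real ((part_fps \<phi> ^ i) $ k) * z ^ k)"
    have B: "summable (\<lambda>k. norm (B k))" "B sums (suminf A ^ i)"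
      using Suc by (auto simp: B_def)
    have eq: "of_real ((part_fps \<phi> ^ Suc i) $ k) * z ^ k = (\<Sum>j\<le>k. A j * B (k - j))" for k
      by (simp add: fps_mult_nth A_def B_def sum_distrib_right atLeast0AtMost)
         (intro sum.cong refl, simp add: mult_ac power_add[symmetric])
    have 1: "(\<lambda>k. \<Sum>j\<le>k. A j * B (k - j)) sums (suminf A * suminf B)"
      by (rule Cauchy_product_sums[OF A B(1)])
    have AA: "summable (\<lambda>k. norm (norm (A k)))" "summable (\<lambda>k. norm (norm (B k)))" using A B by simp_all
    have "summable (\<lambda>k. \<Sum>j\<le>k. norm (A j) * norm (B (k - j)))"
      by (rule summable_Cauchy_product[OF AA])
    then have 2: "summable (\<lambda>k. norm (\<Sum>j\<le>k. A j * B (k - j)))"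
      by (rule summable_comparison_test'[where N=0])
         (auto intro!: order.trans[OF norm_sum] sum_mono simp: norm_mult)
    show ?case unfolding eq using 1 2 sums_unique[OF B(2)] by simp
  qed
  then show "(\<lambda>k. of_real ((part_fps \<phi> ^ i) $ k) * z ^ k) sums ((\<Sum>j. of_real (\<phi> j / real j) * z ^ j) ^ i)"
     and "summable (\<lambda>k. (part_fps \<phi> ^ i) $ k * norm z ^ k)"
    using part_fps_power_nonneg[OF assms(1)] sA by (auto simp: norm_mult norm_power)
qed

text \<open>
  The formal identity defining \<open>h_coeff\<close> holds on the whole closed disc of absolute convergence of the
  exponent, without any appeal to analyticity: in the double family \<open>(i, k) \<mapsto> a\<^sub>i\<^sub>k * z ^ k\<close>, where
  \<open>a\<^sub>i\<^sub>k\<close> is the \<open>k\<close>th coefficient of \<open>part_fps \<phi> ^ i / i!\<close>, summing over \<open>k\<close> first gives the exponential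
  series, and summing over \<open>i\<close> first gives the power series of the \<open>h_coeff\<close>.
\<close>
lemma h_coeff_generating_function:
  fixes z :: complex
  assumes pos: "\<And>j. 1 \<le> j \<Longrightarrow> 0 \<le> \<phi> j" and sm: "summable (\<lambda>j. \<phi> j / real j * norm z ^ j)"
  shows "(\<lambda>k. of_real (h_coeff \<phi> (int k)) * z ^ k) sums exp (\<Sum>j. of_real (\<phi> j / real j) * z ^ j)"
proof -
  let ?c = "\<lambda>i k. (part_fps \<phi> ^ i) $ k"
  define f where "f = (\<lambda>(i, k). of_real (?c i k / fact i) * z ^ k)"
  define F where "F = (\<Sum>j. of_real (\<phi> j / real j) * z ^ j)"
  define Fr where "Fr = (\<Sum>j. \<phi> j / real j * norm z ^ j)"
  note nn = part_fps_power_nonneg[OF pos]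
  have smr: "summable (\<lambda>j. \<phi> j / real j * norm (norm z) ^ j)" using sm by simp
  have hs: "((\<lambda>k. ?c i k / fact i * norm z ^ k) has_sum (Fr ^ i / fact i)) UNIV" for i
  proof (rule sums_nonneg_imp_has_sum)
    have "(\<lambda>k. ?c i k * norm z ^ k) sums (Fr ^ i)"
      using part_fps_power_sums(2)[OF pos smr, of i] by (simp add: Fr_def)
    then show "(\<lambda>k. ?c i k / fact i * norm z ^ k) sums (Fr ^ i / fact i)"
      using sums_divide[of _ _ "fact i :: real"] by (simp add: field_simps)
  qed (auto simp: nn)
  have Frnn: "0 \<le> Fr" unfolding Fr_def
  proof (rule suminf_nonneg[OF sm])
    fix j show "0 \<le> \<phi> j / real j * norm z ^ j" using pos by (cases j) auto
  qed
  have "((\<lambda>i. Fr ^ i / fact i) has_sum exp Fr) UNIV"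
    using exp_converges[of Fr] Frnn by (intro sums_nonneg_imp_has_sum) (auto simp: divide_inverse mult.commute)
  then have sumg: "(\<lambda>i. Fr ^ i / fact i) summable_on UNIV" by (rule has_sum_imp_summable)
  have "(\<lambda>(i,k). ?c i k / fact i * norm z ^ k) summable_on Sigma UNIV (\<lambda>_. UNIV)"
    by (rule summable_on_SigmaI[OF _ sumg]) (use hs nn in auto)
  then have "(\<lambda>x. norm (f x)) summable_on Sigma UNIV (\<lambda>_. UNIV)"
    by (rule summable_on_cong[THEN iffD1, rotated]) (auto simp: f_def norm_mult norm_power norm_divide nn)
  then have sf: "f summable_on Sigma UNIV (\<lambda>_. UNIV)" by (rule abs_summable_summable)
  have hsc: "((\<lambda>k. f (i, k)) has_sum (F ^ i / fact i)) UNIV" for i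
  proof (rule norm_summable_imp_has_sum)
    show "summable (\<lambda>k. norm (f (i, k)))"
      using summable_divide[OF part_fps_power_sums(1)[OF pos sm], of i "fact i"] nn
      by (simp add: f_def norm_mult norm_power norm_divide field_simps)
    show "(\<lambda>k. f (i, k)) sums (F ^ i / fact i)"
      using sums_divide[OF part_fps_power_sums(2)[OF pos sm, of i], of "fact i"]
      by (simp add: f_def F_def field_simps)
  qed
  have hse: "((\<lambda>i. F ^ i / fact i) has_sum exp F) UNIV"
  proof (rule norm_summable_imp_has_sum)
    show "summable (\<lambda>n. norm (F ^ n / fact n))"
      using summable_norm_exp[of F] by (simp add: norm_divide norm_power divide_inverse scaleR_conv_of_real norm_mult mult.commute)
    show "(\<lambda>n. F ^ n / fact n) sums exp F"
      using exp_converges[of F] by (simp add: scaleR_conv_of_real divide_inverse mult.commute)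
  qed
  have "(f has_sum exp F) (UNIV \<times> UNIV)"
    by (rule has_sum_SigmaI[OF hsc hse sf])
  then have "((\<lambda>(k, i). f (i, k)) has_sum exp F) (UNIV \<times> UNIV)"
    by (subst has_sum_swap[symmetric]) (auto simp: case_prod_unfold)
  then have "((\<lambda>k. of_real (h_coeff \<phi> (int k)) * z ^ k) has_sum exp F) UNIV"
  proof (rule has_sum_SigmaD)
    fix k :: nat
    have z: "?c i k = 0" if "k < i" for i
      using that by (intro startsby_zero_power_prefix[rule_format]) (auto simp: part_fps_def)
    have "((\<lambda>i. f (i, k)) has_sum (\<Sum>i\<le>k. f (i, k))) UNIV"
      by (rule has_sum_finite_neutralI) (auto simp: f_def z not_le)
    also have "(\<Sum>i\<le>k. f (i, k)) = of_real (h_coeff \<phi> (int k)) * z ^ k"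
      by (simp add: h_coeff_expand f_def sum_distrib_right)
    finally show "((\<lambda>i. case (k, i) of (k, i) \<Rightarrow> f (i, k)) has_sum of_real (h_coeff \<phi> (int k)) * z ^ k) UNIV"
      by simp
  qed
  then show ?thesis unfolding F_def by (rule has_sum_imp_sums)
qed

text \<open>
  The law of \<open>\<Sum>j. j * R\<^sub>j\<close> for independent Poisson variables \<open>R\<^sub>j\<close> with mean \<open>\<phi> j / j\<close>; when \<open>\<phi>\<close>
  is nonnegative and \<open>\<phi> 0 = 0\<close>, its mean is \<open>\<Sum>j. \<phi> j\<close> and its variance \<open>\<Sum>j. j * \<phi> j\<close>.
\<close>
definition compound_poisson :: "(nat \<Rightarrow> real) \<Rightarrow> nat \<Rightarrow> real" where
  "compound_poisson \<phi> k = h_coeff \<phi> (int k) * exp (- (\<Sum>j. \<phi> j / real j))"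

text \<open>
  Normalizing and centring the generating function turns each \<open>exp (s * j)\<close> in the exponent into its
  second-order Taylor remainder. Imaginary \<open>s\<close> gives the characteristic function, real \<open>s\<close> the
  exponential moments.
\<close>
lemma compound_poisson_transform:
  fixes s :: complex
  assumes pos: "\<And>j. 0 \<le> \<phi> j" and zero: "\<phi> 0 = 0"
    and sm: "summable (\<lambda>j. \<phi> j / real j * exp (real j * max 0 (Re s)))"
    and sm1: "summable \<phi>"
  defines "\<mu> \<equiv> suminf \<phi>"
  shows "(\<lambda>k. of_real (compound_poisson \<phi> k) * exp (s * of_real (real k - \<mu>))) sums
     exp (\<Sum>j. of_real (\<phi> j / real j) * (exp (s * of_nat j) - 1 - s * of_nat j))"
    (is "?f sums exp ?S")
proof -
  define \<Lambda> where "\<Lambda> = (\<Sum>j. \<phi> j / real j)"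
  have nn: "0 \<le> \<phi> j / real j" for j using pos by simp
  have smz: "summable (\<lambda>j. \<phi> j / real j * norm (exp s) ^ j)"
  proof (rule summable_comparison_test'[OF sm, of 0])
    fix j :: nat
    have "norm (exp s) ^ j \<le> exp (real j * max 0 (Re s))"
      by (simp add: norm_exp_eq_Re exp_of_nat_mult[symmetric] mult_left_mono)
    then show "norm (\<phi> j / real j * norm (exp s) ^ j) \<le> \<phi> j / real j * exp (real j * max 0 (Re s))"
      using nn[of j] by (simp add: abs_mult mult_left_mono del: times_divide_eq_left abs_divide)
  qed
  have sm\<Lambda>: "summable (\<lambda>j. \<phi> j / real j)"
  proof (rule summable_comparison_test'[OF sm, of 0])
    fix j :: nat
    show "norm (\<phi> j / real j) \<le> \<phi> j / real j * exp (real j * max 0 (Re s))"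
      using nn[of j] by (simp add: abs_mult mult_left_le del: times_divide_eq_left abs_divide)
         (metis mult_left_mono mult.right_neutral one_le_exp_iff max.cobounded1 of_nat_0_le_iff zero_le_mult_iff)
  qed
  have "summable (\<lambda>j. norm (complex_of_real (\<phi> j / real j) * exp s ^ j))"
    using smz nn by (simp add: norm_mult norm_power del: times_divide_eq_left of_real_divide abs_divide)
  then have s1: "(\<lambda>j. complex_of_real (\<phi> j / real j) * exp s ^ j) sums (\<Sum>j. of_real (\<phi> j / real j) * exp s ^ j)"
    by (rule summable_sums[OF summable_norm_cancel])
  have s2: "(\<lambda>j. complex_of_real (\<phi> j / real j)) sums of_real \<Lambda>"
    unfolding \<Lambda>_def by (intro sums_of_real summable_sums sm\<Lambda>)
  have s3: "(\<lambda>j. s * complex_of_real (\<phi> j)) sums (s * of_real \<mu>)"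
    unfolding \<mu>_def by (intro sums_mult sums_of_real summable_sums sm1)
  have "(\<lambda>j. of_real (\<phi> j / real j) * exp s ^ j - of_real (\<phi> j / real j) - s * of_real (\<phi> j))
     sums ((\<Sum>j. of_real (\<phi> j / real j) * exp s ^ j) - of_real \<Lambda> - s * of_real \<mu>)"
    by (intro sums_diff s1 s2 s3)
  also have "(\<lambda>j. of_real (\<phi> j / real j) * exp s ^ j - of_real (\<phi> j / real j) - s * of_real (\<phi> j))
     = (\<lambda>j. of_real (\<phi> j / real j) * (exp (s * of_nat j) - 1 - s * of_nat j))"
  proof
    fix j
    show "of_real (\<phi> j / real j) * exp s ^ j - of_real (\<phi> j / real j) - s * of_real (\<phi> j)
       = of_real (\<phi> j / real j) * (exp (s * of_nat j) - 1 - s * of_nat j)"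
      by (cases "j = 0") (simp_all add: exp_of_nat2_mult field_simps zero)
  qed
  finally have S: "?S = (\<Sum>j. of_real (\<phi> j / real j) * exp s ^ j) - of_real \<Lambda> - s * of_real \<mu>"
    by (rule sums_unique[symmetric])
  have "(\<lambda>k. (of_real (h_coeff \<phi> (int k)) * exp s ^ k) * exp (- of_real \<Lambda> - s * of_real \<mu>)) sums
     (exp (\<Sum>j. of_real (\<phi> j / real j) * exp s ^ j) * exp (- of_real \<Lambda> - s * of_real \<mu>))"
    by (rule sums_mult2[OF h_coeff_generating_function[OF pos smz]])
  also have "exp (\<Sum>j. of_real (\<phi> j / real j) * exp s ^ j) * exp (- of_real \<Lambda> - s * of_real \<mu>) = exp ?S"
    unfolding S exp_add[symmetric] by (simp add: algebra_simps)
  also have "(\<lambda>k. (of_real (h_coeff \<phi> (int k)) * exp s ^ k) * exp (- of_real \<Lambda> - s * of_real \<mu>)) = ?f"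
  proof
    fix k
    have "exp s ^ k = exp (s * of_nat k)" by (simp add: exp_of_nat2_mult)
    then have "exp s ^ k * exp (- of_real \<Lambda> - s * of_real \<mu>)
       = of_real (exp (- \<Lambda>)) * exp (s * of_real (real k - \<mu>))"
      by (simp add: exp_of_real[symmetric] exp_add[symmetric] algebra_simps)
    then show "(of_real (h_coeff \<phi> (int k)) * exp s ^ k) * exp (- of_real \<Lambda> - s * of_real \<mu>) = ?f k"
      by (simp add: mult.assoc compound_poisson_def \<Lambda>_def[symmetric])
  qed
  finally show ?thesis .
qed

section \<open>Weighted sums over spatial partitions with a given support\<close>

lemma sum_mset_conv_sum_count: "sum_mset M = (\<Sum>j\<in>set_mset M. j * count M j)" for M :: "nat multiset"
proof (induction M)
  case (add x M)
  let ?B = "insert x (set_mset M)"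
  have "(\<Sum>j\<in>set_mset (add_mset x M). j * count (add_mset x M) j)
      = (\<Sum>j\<in>?B. j * count M j + (if j = x then j else 0))"
    by (auto intro!: sum.cong)
  also have "\<dots> = (\<Sum>j\<in>?B. j * count M j) + x"
    by (simp add: sum.distrib)
  also have "(\<Sum>j\<in>?B. j * count M j) = (\<Sum>j\<in>set_mset M. j * count M j)"
    by (rule sum.mono_neutral_right) (auto simp: not_in_iff)
  finally show ?case using add.IH by simp
qed simp

lemma occupation_eq: "occupation l x = sum_mset (l x)"
  unfolding occupation_def multiplicity_of_def by (rule sum_mset_conv_sum_count[symmetric])

definition part_weight :: "(real ^ 'd \<Rightarrow> real) \<Rightarrow> (nat \<Rightarrow> real) \<Rightarrow> real \<Rightarrow> int ^ 'd \<Rightarrow> nat \<Rightarrow> real" where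
  "part_weight V \<theta> L x j = \<theta> j / real j * exp (- real j * V (lattice_point x /\<^sub>R L))"

definition multiset_weight :: "(nat \<Rightarrow> real) \<Rightarrow> nat multiset \<Rightarrow> real" where
  "multiset_weight u M = (\<Prod>j\<in>set_mset M. 1 / fact (count M j) * u j ^ count M j)"

lemma multiset_weight_empty [simp]: "multiset_weight u {#} = 1"
  by (simp add: multiset_weight_def)

text \<open>
  The factorial cancels the multiplicity: this is what makes the removal of one part,
  counted with multiplicity, act on weights as division by the weight of the part.
\<close>
lemma multiset_weight_add_mset:
  "real (Suc (count M j)) * multiset_weight u (add_mset j M) = u j * multiset_weight u M"
proof -
  let ?F = "\<lambda>N i. 1 / fact (count N i) * u i ^ count N i"
  let ?B = "insert j (set_mset M)"
  have "multiset_weight u M = (\<Prod>i\<in>?B. ?F M i)"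
    unfolding multiset_weight_def by (rule prod.mono_neutral_left) (auto simp: not_in_iff)
  also have "\<dots> = ?F M j * (\<Prod>i\<in>?B - {j}. ?F M i)"
    by (rule prod.remove) auto
  finally have 1: "multiset_weight u M = ?F M j * (\<Prod>i\<in>?B - {j}. ?F M i)" .
  have "multiset_weight u (add_mset j M) = (\<Prod>i\<in>?B. ?F (add_mset j M) i)"
    unfolding multiset_weight_def by simp
  also have "\<dots> = ?F (add_mset j M) j * (\<Prod>i\<in>?B - {j}. ?F (add_mset j M) i)"
    by (rule prod.remove) auto
  also have "(\<Prod>i\<in>?B - {j}. ?F (add_mset j M) i) = (\<Prod>i\<in>?B - {j}. ?F M i)"
    by (rule prod.cong) auto
  finally have "real (Suc (count M j)) * multiset_weight u (add_mset j M)
      = (real (Suc (count M j)) * (1 / fact (Suc (count M j)))) * u j * u j ^ count M j * (\<Prod>i\<in>?B - {j}. ?F M i)"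
    by (simp add: mult_ac)
  also have "real (Suc (count M j)) * (1 / fact (Suc (count M j))) = 1 / fact (count M j)"
    by simp
  finally show ?thesis unfolding 1 by simp
qed

text \<open>
  Sites carrying the empty partition contribute the factor 1, so the product may run over any finite
  superset of the support; this allows weights of different partitions to be compared.
\<close>
lemma weight_eq:
  assumes "finite A" "{x. l x \<noteq> {#}} \<subseteq> A"
  shows "weight V \<theta> L l = (\<Prod>x\<in>A. multiset_weight (part_weight V \<theta> L x) (l x))"
proof -
  have "weight V \<theta> L l = (\<Prod>x | l x \<noteq> {#}. multiset_weight (part_weight V \<theta> L x) (l x))"
    by (simp add: weight_def multiset_weight_def part_weight_def multiplicity_of_def)
  also have "\<dots> = (\<Prod>x\<in>A. multiset_weight (part_weight V \<theta> L x) (l x))"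
    by (rule prod.mono_neutral_left) (use assms in auto)
  finally show ?thesis .
qed

lemma weight_add_part:
  assumes "finite {x. l x \<noteq> {#}}"
  shows "real (Suc (count (l x) j)) * weight V \<theta> L (l(x := add_mset j (l x)))
    = part_weight V \<theta> L x j * weight V \<theta> L l"
proof -
  let ?A = "insert x {x. l x \<noteq> {#}}" and ?l = "l(x := add_mset j (l x))"
  let ?w = "\<lambda>l y. multiset_weight (part_weight V \<theta> L y) (l y)"
  have fin: "finite ?A" using assms by simp
  have "weight V \<theta> L ?l = (\<Prod>y\<in>?A. ?w ?l y)"
    by (rule weight_eq[OF fin]) auto
  also have "\<dots> = ?w ?l x * (\<Prod>y\<in>?A - {x}. ?w ?l y)"
    by (rule prod.remove) (use fin in auto)
  also have "(\<Prod>y\<in>?A - {x}. ?w ?l y) = (\<Prod>y\<in>?A - {x}. ?w l y)"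
    by (rule prod.cong) auto
  finally have 1: "weight V \<theta> L ?l = ?w ?l x * (\<Prod>y\<in>?A - {x}. ?w l y)" .
  have "weight V \<theta> L l = (\<Prod>y\<in>?A. ?w l y)"
    by (rule weight_eq[OF fin]) auto
  also have "\<dots> = ?w l x * (\<Prod>y\<in>?A - {x}. ?w l y)"
    by (rule prod.remove) (use fin in auto)
  finally have 2: "weight V \<theta> L l = ?w l x * (\<Prod>y\<in>?A - {x}. ?w l y)" .
  show ?thesis
    using multiset_weight_add_mset[of "l x" j "part_weight V \<theta> L x"] unfolding 1 2 by (simp add: mult.assoc[symmetric])
qed

definition partitions_on :: "(int ^ 'd) set \<Rightarrow> nat \<Rightarrow> (int ^ 'd \<Rightarrow> nat multiset) set" where
  "partitions_on X k = {l \<in> spatial_partitions k. \<forall>x. x \<notin> X \<longrightarrow> l x = {#}}"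

lemma total_eq:
  assumes "finite A" "{x. l x \<noteq> {#}} \<subseteq> A"
  shows "(\<Sum>x | l x \<noteq> {#}. sum_mset (l x)) = (\<Sum>x\<in>A. sum_mset (l x))"
  by (rule sum.mono_neutral_left) (use assms in auto)

lemma total_upd:
  fixes l :: "int ^ 'd \<Rightarrow> nat multiset"
  assumes "finite {x. l x \<noteq> {#}}"
  shows "(\<Sum>y | (l(x := M)) y \<noteq> {#}. sum_mset ((l(x := M)) y)) + sum_mset (l x)
     = (\<Sum>y | l y \<noteq> {#}. sum_mset (l y)) + sum_mset M"
proof -
  let ?A = "insert x {x. l x \<noteq> {#}}" and ?l = "l(x := M)"
  have fin: "finite ?A" using assms by simp
  have "(\<Sum>y | ?l y \<noteq> {#}. sum_mset (?l y)) = (\<Sum>y\<in>?A. sum_mset (?l y))"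
    by (rule total_eq[OF fin]) auto
  also have "\<dots> = sum_mset (?l x) + (\<Sum>y\<in>?A - {x}. sum_mset (?l y))"
    by (rule sum.remove) (use fin in auto)
  also have "(\<Sum>y\<in>?A - {x}. sum_mset (?l y)) = (\<Sum>y\<in>?A - {x}. sum_mset (l y))"
    by (rule sum.cong) auto
  finally have 1: "(\<Sum>y | ?l y \<noteq> {#}. sum_mset (?l y)) = sum_mset (?l x) + (\<Sum>y\<in>?A - {x}. sum_mset (l y))" .
  have "(\<Sum>y | l y \<noteq> {#}. sum_mset (l y)) = (\<Sum>y\<in>?A. sum_mset (l y))"
    by (rule total_eq[OF fin]) auto
  also have "\<dots> = sum_mset (l x) + (\<Sum>y\<in>?A - {x}. sum_mset (l y))"
    by (rule sum.remove) (use fin in auto)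
  finally show ?thesis using 1 by simp
qed

lemma finite_support_upd:
  "finite {x. l x \<noteq> {#}} \<Longrightarrow> finite {y. (l(x := M)) y \<noteq> {#}}"
  by (rule finite_subset[of _ "insert x {x. l x \<noteq> {#}}"]) auto

lemma finite_support: "l \<in> partitions_on X k \<Longrightarrow> finite {x. l x \<noteq> {#}}"
  by (simp add: partitions_on_def spatial_partitions_def)

lemma partitions_on_upd:
  assumes "l \<in> partitions_on X k" "x \<in> X" "integer_partition M" "k' + sum_mset (l x) = k + sum_mset M"
  shows "l(x := M) \<in> partitions_on X k'"
proof -
  have l: "\<And>y. integer_partition (l y)" "finite {x. l x \<noteq> {#}}" "(\<Sum>y | l y \<noteq> {#}. sum_mset (l y)) = k"
    "\<And>y. y \<notin> X \<Longrightarrow> l y = {#}"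
    using assms(1) by (auto simp: partitions_on_def spatial_partitions_def)
  have "(\<Sum>y | (l(x := M)) y \<noteq> {#}. sum_mset ((l(x := M)) y)) = k'"
    using total_upd[OF l(2), of x M] l(3) assms(4) by linarith
  then show ?thesis
    unfolding partitions_on_def spatial_partitions_def mem_Collect_eq
    using l(1,4) assms(2,3) finite_support_upd[OF l(2)] by auto
qed

lemma partitions_on_0: "partitions_on X 0 = {\<lambda>_. {#}}"
proof -
  have "l = (\<lambda>_. {#})" if l: "l \<in> partitions_on X 0" for l
  proof (rule ext, rule ccontr)
    fix x assume x: "l x \<noteq> {#}"
    have "sum_mset (l x) = 0"
      using l x by (auto simp: partitions_on_def spatial_partitions_def)
    moreover obtain j where j: "j \<in># l x" using x by (meson multiset_nonemptyE)
    moreover have "1 \<le> j" using l j by (auto simp: partitions_on_def spatial_partitions_def integer_partition_def)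
    ultimately show False by (auto simp: sum_mset_0_iff)
  qed
  then show ?thesis by (auto simp: partitions_on_def spatial_partitions_def integer_partition_def)
qed

lemma part_bounds:
  assumes "l \<in> partitions_on X k" "j \<in># l x"
  shows "x \<in> X" "1 \<le> j" "sum_mset (l x) \<le> k" "j \<le> sum_mset (l x)"
proof -
  have l: "\<And>y. integer_partition (l y)" "finite {x. l x \<noteq> {#}}" "(\<Sum>y | l y \<noteq> {#}. sum_mset (l y)) = k"
    "\<And>y. y \<notin> X \<Longrightarrow> l y = {#}"
    using assms(1) by (auto simp: partitions_on_def spatial_partitions_def)
  show "x \<in> X" using l(4) assms(2) by force
  show "1 \<le> j" using l(1)[of x] assms(2) by (auto simp: integer_partition_def)
  have "sum_mset (l x) \<le> (\<Sum>y | l y \<noteq> {#}. sum_mset (l y))"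
    by (rule member_le_sum[of x]) (use l(2) assms(2) in auto)
  then show "sum_mset (l x) \<le> k" using l(3) by simp
  show "j \<le> sum_mset (l x)" using assms(2) by (metis le_add1 multi_member_split sum_mset.add_mset)
qed

lemma multiset_weight_nonneg: "(\<And>j. j \<in># M \<Longrightarrow> 0 \<le> u j) \<Longrightarrow> 0 \<le> multiset_weight u M"
  unfolding multiset_weight_def by (auto intro!: prod_nonneg)

lemma weight_nonneg:
  assumes "\<And>j. 1 \<le> j \<Longrightarrow> 0 \<le> \<theta> j" "l \<in> partitions_on X k"
  shows "0 \<le> weight V \<theta> L l"
  unfolding weight_eq[OF finite_support[OF assms(2)] order.refl]
  using part_bounds(2)[OF assms(2)] assms(1)
  by (auto intro!: prod_nonneg multiset_weight_nonneg simp: part_weight_def)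

text \<open>
  Let \<open>W k\<close> be the sum in question. Writing the total \<open>k\<close> of \<open>l\<close> as the sum of its parts and removing the
  marked part gives \<open>k * W k = (\<Sum>x j. j * w x j * W (k - j))\<close> with \<open>w x j\<close> the weight of a part \<open>j\<close>
  at \<open>x\<close>. As \<open>(\<Sum>x\<in>X. j * w x j) = \<theta> j * lam j\<close>, this is the recurrence of \<open>h_coeff\<close>.
  Summability comes out of the same induction, because all terms are nonnegative.
\<close>
lemma weight_has_sum:
  fixes X :: "(int ^ 'd) set"
  assumes \<theta>: "\<And>j. 1 \<le> j \<Longrightarrow> 0 \<le> \<theta> j"
    and lam: "\<And>j. 1 \<le> j \<Longrightarrow> ((\<lambda>x. exp (- real j * V (lattice_point x /\<^sub>R L))) has_sum lam j) X"
  shows "(weight V \<theta> L has_sum h_coeff (\<lambda>j. \<theta> j * lam j) (int k)) (partitions_on X k)"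
proof (induction k rule: less_induct)
  case (less k)
  let ?h = "\<lambda>k. h_coeff (\<lambda>j. \<theta> j * lam j) (int k)"
  let ?w = "part_weight V \<theta> L" and ?W = "weight V \<theta> L"
  show ?case
  proof (cases "k = 0")
    case True
    have "(?W has_sum (\<Sum>l\<in>{\<lambda>_. {#}}. ?W l)) {\<lambda>_. {#}}"
      by (rule has_sum_finite) simp
    moreover have "?W (\<lambda>_. {#}) = 1" by (simp add: weight_def)
    ultimately show ?thesis using True by (simp add: partitions_on_0)
  next
    case False
    \<comment> \<open>pairs of a part \<open>j\<close> at a site \<open>x\<close>, with the partitions left after its removal\<close>
    define P where "P = X \<times> {1..k}"
    define Q where "Q = (\<lambda>(x :: int ^ 'd, j). partitions_on X (k - j))"
    define f where "f = (\<lambda>((x, j), l). real j * ?w x j * ?W l)"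
    have w_nn: "0 \<le> ?w x j" if "1 \<le> j" for x j using \<theta>[OF that] by (simp add: part_weight_def)
    have h_nn: "0 \<le> ?h i" for i
      by (rule h_coeff_nonneg) (use \<theta> has_sum_nonneg[OF lam] in auto)
    have inner: "((\<lambda>l. f (p, l)) has_sum (case p of (x, j) \<Rightarrow> real j * ?w x j * ?h (k - j))) (Q p)" if p: "p \<in> P" for p
    proof -
      obtain x j where xj: "p = (x, j)" by (cases p)
      have "(?W has_sum ?h (k - j)) (partitions_on X (k - j))"
        by (rule less.IH) (use p xj in \<open>auto simp: P_def\<close>)
      from has_sum_cmult_right[OF this, of "real j * ?w x j"] show ?thesis by (simp add: xj f_def Q_def)
    qed
    have o1: "((\<lambda>x. real j * ?w x j * ?h (k - j)) has_sum (\<theta> j * lam j * ?h (k - j))) X" if j: "j \<in> {1..k}" for j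
    proof -
      have j0: "j \<noteq> 0" "1 \<le> j" using j by auto
      have eq: "(\<lambda>x. real j * ?w x j * ?h (k - j)) = (\<lambda>x. \<theta> j * ?h (k - j) * exp (- real j * V (lattice_point x /\<^sub>R L)))"
        using j0 by (auto simp: part_weight_def fun_eq_iff)
      have "((\<lambda>x. \<theta> j * ?h (k - j) * exp (- real j * V (lattice_point x /\<^sub>R L))) has_sum (\<theta> j * ?h (k - j) * lam j)) X"
        by (rule has_sum_cmult_right[OF lam[OF j0(2)]])
      then show ?thesis unfolding eq by (simp add: mult_ac)
    qed
    have o2: "((\<lambda>j. \<theta> j * lam j * ?h (k - j)) has_sum (\<Sum>j=1..k. \<theta> j * lam j * ?h (k - j))) {1..k}"
      by (rule has_sum_finite) simp
    have rec: "(\<Sum>j=1..k. \<theta> j * lam j * ?h (k - j)) = real k * ?h k"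
      using False by (subst h_coeff_recurrence) auto
    have "((\<lambda>(j, x). real j * ?w x j * ?h (k - j)) has_sum (real k * ?h k)) ({1..k} \<times> X)"
      using o1 has_sum_imp_summable[OF o2] w_nn h_nn unfolding rec[symmetric]
      by (intro has_sum_SigmaI[OF _ o2] summable_on_SigmaI[OF _ has_sum_imp_summable[OF o2]])
        (auto intro!: mult_nonneg_nonneg simp del: of_nat_diff)
    then have outer: "((\<lambda>(x, j). real j * ?w x j * ?h (k - j)) has_sum (real k * ?h k)) P"
      unfolding P_def by (subst has_sum_swap) (auto simp: case_prod_unfold)
    have f_sum: "(f has_sum (real k * ?h k)) (Sigma P Q)"
    proof (rule has_sum_SigmaI[OF inner outer])
      show "f summable_on Sigma P Q"
      proof (rule summable_on_SigmaI[OF inner has_sum_imp_summable[OF outer]])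
        fix p l assume "p \<in> P" "l \<in> Q p"
        then show "0 \<le> f (p, l)"
          by (auto simp: P_def Q_def f_def intro!: mult_nonneg_nonneg w_nn weight_nonneg[OF \<theta>])
      qed
    qed
    \<comment> \<open>the parts of a given partition\<close>
    define R where "R = (\<lambda>l :: int ^ 'd \<Rightarrow> nat multiset. Sigma {x. l x \<noteq> {#}} (\<lambda>x. set_mset (l x)))"
    define g where "g = (\<lambda>(l :: int ^ 'd \<Rightarrow> nat multiset, (x, j)). real j * real (count (l x) j) * ?W l)"
    have "(f has_sum (real k * ?h k)) (Sigma P Q) \<longleftrightarrow> (g has_sum (real k * ?h k)) (Sigma (partitions_on X k) R)"
    proof (rule has_sum_reindex_bij_witness[where j = "\<lambda>((x, j), l). (l(x := add_mset j (l x)), (x, j))"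
          and i = "\<lambda>(l, (x, j)). ((x, j), l(x := l x - {#j#}))"])
      fix a assume a: "a \<in> Sigma P Q"
      then obtain x j l where xjl: "a = ((x, j), l)" "x \<in> X" "1 \<le> j" "j \<le> k" "l \<in> partitions_on X (k - j)"
        by (auto simp: P_def Q_def)
      show "(case case a of (xa, xb) \<Rightarrow> (case xa of (x, j) \<Rightarrow> \<lambda>l. (l(x := add_mset j (l x)), x, j)) xb of
          (l, x, j) \<Rightarrow> ((x, j), l(x := l x - {#j#}))) = a"
        by (simp add: xjl)
      have "integer_partition (add_mset j (l x))"
        using xjl by (auto simp: partitions_on_def spatial_partitions_def integer_partition_def)
      then have "l(x := add_mset j (l x)) \<in> partitions_on X k"
        using xjl by (intro partitions_on_upd[OF xjl(5)]) auto
      then show "(case a of (xa, xb) \<Rightarrow> (case xa of (x, j) \<Rightarrow> \<lambda>l. (l(x := add_mset j (l x)), x, j)) xb) \<in> Sigma (partitions_on X k) R"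
        by (simp add: xjl R_def)
      show "g (case a of (xa, xb) \<Rightarrow> (case xa of (x, j) \<Rightarrow> \<lambda>l. (l(x := add_mset j (l x)), x, j)) xb) = f a"
        using weight_add_part[OF finite_support[OF xjl(5)], of x j V \<theta> L]
        by (simp add: xjl f_def g_def mult.assoc)
    next
      fix b assume b: "b \<in> Sigma (partitions_on X k) R"
      then obtain x j l where xjl: "b = (l, (x, j))" "l \<in> partitions_on X k" "j \<in># l x"
        by (auto simp: R_def)
      note pb = part_bounds[OF xjl(2,3)]
      show "(case case b of (l, x, j) \<Rightarrow> ((x, j), l(x := l x - {#j#})) of (xa, xb) \<Rightarrow>
          (case xa of (x, j) \<Rightarrow> \<lambda>l. (l(x := add_mset j (l x)), x, j)) xb) = b"
        using xjl by simp
      have "integer_partition (l x - {#j#})"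
        using xjl by (auto simp: partitions_on_def spatial_partitions_def integer_partition_def dest: in_diffD)
      moreover have "sum_mset (l x - {#j#}) + j = sum_mset (l x)"
        using xjl(3) by (metis add.commute insert_DiffM sum_mset.add_mset)
      ultimately have "l(x := l x - {#j#}) \<in> partitions_on X (k - j)"
        using pb by (intro partitions_on_upd[OF xjl(2)]) auto
      then show "(case b of (l, x, j) \<Rightarrow> ((x, j), l(x := l x - {#j#}))) \<in> Sigma P Q"
        using pb by (auto simp: xjl(1) P_def Q_def)
    qed simp
    with f_sum have "(g has_sum (real k * ?h k)) (Sigma (partitions_on X k) R)" by simp
    \<comment> \<open>summing out the marked part of \<open>l\<close> gives back the factor \<open>k\<close>\<close>
    then have "((\<lambda>l. real k * ?W l) has_sum (real k * ?h k)) (partitions_on X k)"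
    proof (rule has_sum_SigmaD)
      fix l assume l: "l \<in> partitions_on X k"
      note fin = finite_support[OF l]
      have "((\<lambda>p. g (l, p)) has_sum (\<Sum>p\<in>R l. g (l, p))) (R l)"
        by (rule has_sum_finite) (use fin in \<open>auto simp: R_def\<close>)
      also have "(\<Sum>p\<in>R l. g (l, p)) = (\<Sum>x | l x \<noteq> {#}. \<Sum>j\<in>set_mset (l x). real j * real (count (l x) j) * ?W l)"
        unfolding R_def by (subst sum.Sigma) (use fin in \<open>auto simp: g_def case_prod_unfold\<close>)
      also have "\<dots> = real (\<Sum>x | l x \<noteq> {#}. sum_mset (l x)) * ?W l"
        by (simp add: sum_mset_conv_sum_count sum_distrib_right)
      also have "(\<Sum>x | l x \<noteq> {#}. sum_mset (l x)) = k"
        using l by (simp add: partitions_on_def spatial_partitions_def)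
      finally show "((\<lambda>p. g (l, p)) has_sum (real k * ?W l)) (R l)" .
    qed
    from has_sum_cmult_right[OF this, of "1 / real k"] show ?thesis using False by simp
  qed
qed

section \<open>The law of the occupation of the origin\<close>

lemma spatial_partitions_eq: "spatial_partitions n = partitions_on UNIV n"
  by (simp add: partitions_on_def)

lemma weight_split_origin:
  assumes "l1 \<in> partitions_on {0} m" "l2 \<in> partitions_on (- {0}) k"
  shows "weight V \<theta> L (l2(0 := l1 0)) = weight V \<theta> L l1 * weight V \<theta> L l2"
proof -
  let ?w = "\<lambda>l y. multiset_weight (part_weight V \<theta> L y) (l y)"
  let ?A = "insert 0 {x. l2 x \<noteq> {#}}"
  have fin: "finite ?A" using finite_support[OF assms(2)] by simp
  have l1: "l1 x = {#}" if "x \<noteq> 0" for x using assms(1) that by (auto simp: partitions_on_def)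
  have l20: "l2 0 = {#}" using assms(2) by (auto simp: partitions_on_def)
  have "weight V \<theta> L l1 = (\<Prod>x\<in>{0}. ?w l1 x)"
    by (rule weight_eq) (use l1 in auto)
  moreover have "weight V \<theta> L l2 = (\<Prod>x\<in>?A. ?w l2 x)"
    by (rule weight_eq[OF fin]) auto
  moreover have "weight V \<theta> L (l2(0 := l1 0)) = (\<Prod>x\<in>?A. ?w (l2(0 := l1 0)) x)"
    by (rule weight_eq[OF fin]) auto
  moreover have "(\<Prod>x\<in>?A - {0}. ?w (l2(0 := l1 0)) x) = (\<Prod>x\<in>?A - {0}. ?w l2 x)"
    by (rule prod.cong) auto
  ultimately show ?thesis
    using prod.remove[OF fin, of 0 "?w l2"] prod.remove[OF fin, of 0 "?w (l2(0 := l1 0))"] l20 by simp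
qed

lemma occupation_le:
  assumes "l \<in> partitions_on X n"
  shows "occupation l x \<le> n"
proof (cases "l x = {#}")
  case False
  then obtain j where "j \<in># l x" by (meson multiset_nonemptyE)
  from part_bounds(3)[OF assms this] show ?thesis by (simp add: occupation_eq)
qed (simp add: occupation_eq)

text \<open>
  A spatial partition splits into its restrictions to the origin and to the other sites. The sum over the
  first is \<open>weight_has_sum\<close> for \<open>X = {0}\<close>, where \<open>lam j = 1\<close> because the potential vanishes there.
\<close>
lemma weight_has_sum_occupation:
  fixes V :: "real ^ 'd \<Rightarrow> real"
  assumes \<theta>: "\<And>j. 1 \<le> j \<Longrightarrow> 0 \<le> \<theta> j" and V0: "V 0 = 0"
    and lam: "\<And>j. 1 \<le> j \<Longrightarrow> ((\<lambda>x. exp (- real j * V (lattice_point x /\<^sub>R L))) has_sum lam j) (- {0})"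
    and mn: "m \<le> n"
  shows "(weight V \<theta> L has_sum (h_coeff \<theta> (int m) * h_coeff (\<lambda>j. \<theta> j * lam j) (int (n - m))))
     {l \<in> spatial_partitions n. occupation l 0 = m}"
proof -
  let ?W = "weight V \<theta> L" and ?h' = "h_coeff (\<lambda>j. \<theta> j * lam j) (int (n - m))"
  let ?P = "partitions_on {0} m :: (int ^ 'd \<Rightarrow> nat multiset) set"
  let ?Q = "partitions_on (- {0}) (n - m) :: (int ^ 'd \<Rightarrow> nat multiset) set"
  have lp0: "lattice_point 0 = (0 :: real ^ 'd)" by (simp add: lattice_point_def vec_eq_iff)
  have "((\<lambda>x. exp (- real j * V (lattice_point x /\<^sub>R L))) has_sum 1) {0}" for j
    using has_sum_finite[of "{0}" "\<lambda>x. exp (- real j * V (lattice_point x /\<^sub>R L))"] by (simp add: lp0 V0)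
  from weight_has_sum[OF \<theta> this] have s1: "(?W has_sum h_coeff \<theta> (int m)) ?P" by simp
  have s2: "(?W has_sum ?h') ?Q" by (rule weight_has_sum[OF \<theta> lam])
  have i: "((\<lambda>l2. case (l1, l2) of (l1, l2) \<Rightarrow> ?W l1 * ?W l2) has_sum (?W l1 * ?h')) ?Q" for l1
    using has_sum_cmult_right[OF s2, of "?W l1"] by simp
  have o: "((\<lambda>l1. ?W l1 * ?h') has_sum (h_coeff \<theta> (int m) * ?h')) ?P"
    using has_sum_cmult_left[OF s1] by simp
  have "((\<lambda>(l1, l2). ?W l1 * ?W l2) has_sum (h_coeff \<theta> (int m) * ?h')) (?P \<times> ?Q)"
    by (intro has_sum_SigmaI[OF i o] summable_on_SigmaI[OF i has_sum_imp_summable[OF o]])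
       (auto intro!: mult_nonneg_nonneg weight_nonneg[OF \<theta>])
  also have "?this \<longleftrightarrow> (?W has_sum (h_coeff \<theta> (int m) * ?h')) {l \<in> spatial_partitions n. occupation l 0 = m}"
  proof (rule has_sum_reindex_bij_witness[where j = "\<lambda>(l1, l2). l2(0 := l1 0)"
      and i = "\<lambda>l. ((\<lambda>x. if x = 0 then l 0 else {#}), l(0 := {#}))"])
    fix a assume "a \<in> ?P \<times> ?Q"
    then obtain l1 l2 where a: "a = (l1, l2)" and l1: "l1 \<in> ?P" and l2: "l2 \<in> ?Q" by auto
    have l1': "l1 x = {#}" if "x \<noteq> 0" for x using l1 that by (auto simp: partitions_on_def)
    have l20: "l2 0 = {#}" using l2 by (auto simp: partitions_on_def)
    have eq: "(\<lambda>x. if x = 0 then (l2(0 := l1 0)) 0 else {#}) = l1" "l2(0 := l1 0, 0 := {#}) = l2"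
      using l1' l20 by auto
    show "(\<lambda>l. ((\<lambda>x. if x = 0 then l 0 else {#}), l(0 := {#}))) (case a of (l1, l2) \<Rightarrow> l2(0 := l1 0)) = a"
      unfolding a prod.case eq ..
    show "?W (case a of (l1, l2) \<Rightarrow> l2(0 := l1 0)) = (case a of (l1, l2) \<Rightarrow> ?W l1 * ?W l2)"
      using weight_split_origin[OF l1 l2] by (simp add: a)
    have "(\<Sum>x | l1 x \<noteq> {#}. sum_mset (l1 x)) = (\<Sum>x\<in>{0}. sum_mset (l1 x))"
      by (rule total_eq) (use l1' in auto)
    then have m: "sum_mset (l1 0) = m" using l1 by (simp add: partitions_on_def spatial_partitions_def)
    have "l2(0 := l1 0) \<in> partitions_on UNIV n"
    proof (rule partitions_on_upd)
      show "l2 \<in> partitions_on UNIV (n - m)" using l2 by (simp add: partitions_on_def)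
      show "integer_partition (l1 0)" using l1 by (simp add: partitions_on_def spatial_partitions_def)
      show "n + sum_mset (l2 0) = n - m + sum_mset (l1 0)" using m mn l20 by simp
    qed simp
    then show "(case a of (l1, l2) \<Rightarrow> l2(0 := l1 0)) \<in> {l \<in> spatial_partitions n. occupation l 0 = m}"
      using m by (simp add: a spatial_partitions_eq occupation_eq)
  next
    fix l :: "int ^ 'd \<Rightarrow> nat multiset" assume "l \<in> {l \<in> spatial_partitions n. occupation l 0 = m}"
    then have l: "l \<in> partitions_on UNIV n" and m: "sum_mset (l 0) = m"
      by (auto simp: spatial_partitions_eq occupation_eq)
    have "l(0 := {#}) \<in> partitions_on UNIV (n - m)"
      by (rule partitions_on_upd[OF l]) (use mn m in \<open>auto simp: integer_partition_def\<close>)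
    then have 2: "l(0 := {#}) \<in> ?Q" by (auto simp: partitions_on_def)
    have "(\<lambda>x. {#})(0 := l 0) \<in> ?P"
    proof (rule partitions_on_upd)
      show "(\<lambda>x. {#}) \<in> partitions_on {0} 0" by (simp add: partitions_on_0)
      show "integer_partition (l 0)" using l by (simp add: partitions_on_def spatial_partitions_def)
    qed (use m in auto)
    also have "(\<lambda>x. {#})(0 := l 0) = (\<lambda>x. if x = 0 then l 0 else {#})" by auto
    finally show "((\<lambda>x. if x = 0 then l 0 else {#}), l(0 := {#})) \<in> ?P \<times> ?Q" using 2 by simp
    show "(case ((\<lambda>x. if x = 0 then l 0 else {#}), l(0 := {#})) of (l1, l2) \<Rightarrow> l2(0 := l1 0)) = l"
      by simp
  qed simp
  finally show ?thesis .
qed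

lemma emeasure_point_measure_has_sum:
  assumes "(w has_sum S) B" "B \<subseteq> A" "\<And>x. x \<in> A \<Longrightarrow> 0 \<le> w x"
  shows "emeasure (point_measure A (\<lambda>x. ennreal (w x))) B = ennreal S"
proof -
  have nn: "\<And>x. x \<in> B \<Longrightarrow> 0 \<le> w x" using assms by auto
  have "w summable_on B" using assms(1) by (rule has_sum_imp_summable)
  then have "(\<lambda>x. norm (w x)) summable_on B"
    by (rule summable_on_cong[THEN iffD1, rotated]) (use nn in auto)
  then have abs: "Infinite_Set_Sum.abs_summable_on w B" by (rule abs_summable_equivalent[THEN iffD1])
  have "emeasure (point_measure A (\<lambda>x. ennreal (w x))) B
     = (\<integral>\<^sup>+x. ennreal (w x) * indicator B x \<partial>count_space A)"
    unfolding point_measure_def using assms(2) by (subst emeasure_density) auto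
  also have "\<dots> = (\<integral>\<^sup>+x. ennreal (w x) \<partial>count_space B)"
    using assms(2) by (subst (1 2) nn_integral_count_space_indicator)
      (auto intro!: nn_integral_cong simp: mult.assoc split: split_indicator)
  also have "\<dots> = ennreal (infsetsum w B)"
    by (rule nn_integral_conv_infsetsum[OF abs nn])
  also have "infsetsum w B = S"
    using infsetsum_infsum[OF abs] infsumI[OF assms(1)] by simp
  finally show ?thesis .
qed

lemma has_sum_finite_disjoint_UN:
  fixes f :: "'a \<Rightarrow> 'b :: topological_comm_monoid_add"
  assumes "finite I" "\<And>i. i \<in> I \<Longrightarrow> (f has_sum g i) (B i)" "disjoint_family_on B I"
  shows "(f has_sum (\<Sum>i\<in>I. g i)) (\<Union>i\<in>I. B i)"
  using assms
proof (induction I rule: finite_induct)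
  case (insert i I)
  have "(f has_sum (g i + (\<Sum>i\<in>I. g i))) (B i \<union> (\<Union>i\<in>I. B i))"
    using insert by (intro has_sum_Un_disjoint insert.IH) (auto simp: disjoint_family_on_def)
  then show ?case using insert by simp
qed simp

lemma partition_function_eq:
  fixes V :: "real ^ 'd \<Rightarrow> real"
  assumes \<theta>: "\<And>j. 1 \<le> j \<Longrightarrow> 0 \<le> \<theta> j" and V0: "V 0 = 0"
    and lam: "\<And>j. 1 \<le> j \<Longrightarrow> ((\<lambda>x. exp (- real j * V (lattice_point x /\<^sub>R L))) has_sum lam j) (- {0})"
  shows "partition_function V \<theta> L n = (\<Sum>m\<le>n. h_coeff \<theta> (int m) * h_coeff (\<lambda>j. \<theta> j * lam j) (int (n - m)))"
proof -
  have eq: "spatial_partitions n = (\<Union>m\<in>{..n}. {l \<in> spatial_partitions n :: (int ^ 'd \<Rightarrow> nat multiset) set. occupation l 0 = m})"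
    using occupation_le[of _ UNIV n] by (auto simp: spatial_partitions_eq)
  have "(weight V \<theta> L has_sum (\<Sum>m\<in>{..n}. h_coeff \<theta> (int m) * h_coeff (\<lambda>j. \<theta> j * lam j) (int (n - m)))) (spatial_partitions n)"
    by (subst eq, rule has_sum_finite_disjoint_UN)
       (use weight_has_sum_occupation[where \<theta> = \<theta>, OF \<theta> V0 lam] in \<open>auto simp: disjoint_family_on_def simp del: of_nat_diff\<close>)
  then show ?thesis unfolding partition_function_def by (rule infsumI)
qed

text \<open>
  Only the expectation of \<open>exp (\<i> * t * H)\<close>, with \<open>H\<close> a normalization of the occupation of the origin,
  will be needed, which is why \<open>F\<close> is complex valued.
\<close>
lemma partition_measure_occupation:
  fixes V :: "real ^ 'd \<Rightarrow> real" and F :: "nat \<Rightarrow> complex"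
  assumes \<theta>: "\<And>j. 1 \<le> j \<Longrightarrow> 0 \<le> \<theta> j" and V0: "V 0 = 0"
    and lam: "\<And>j. 1 \<le> j \<Longrightarrow> ((\<lambda>x. exp (- real j * V (lattice_point x /\<^sub>R L))) has_sum lam j) (- {0})"
    and pos: "0 < partition_function V \<theta> L n"
  shows "prob_space (partition_measure V \<theta> L n)"
    and "(\<integral>l. F (occupation l 0) \<partial>partition_measure V \<theta> L n)
      = (\<Sum>m\<le>n. F m * of_real (h_coeff \<theta> (int m) * h_coeff (\<lambda>j. \<theta> j * lam j) (int (n - m)))) / of_real (partition_function V \<theta> L n)"
proof -
  let ?M = "partition_measure V \<theta> L n" and ?Z = "partition_function V \<theta> L n"
  let ?q = "\<lambda>m. h_coeff \<theta> (int m) * h_coeff (\<lambda>j. \<theta> j * lam j) (int (n - m)) / ?Z"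
  define B where "B = (\<lambda>m. {l \<in> spatial_partitions n :: (int ^ 'd \<Rightarrow> nat multiset) set. occupation l 0 = m})"
  have sp: "space ?M = spatial_partitions n" "sets ?M = Pow (spatial_partitions n)"
    by (auto simp: partition_measure_def space_point_measure sets_point_measure)
  have le: "occupation l 0 \<le> n" if "l \<in> spatial_partitions n" for l :: "int ^ 'd \<Rightarrow> nat multiset"
    using occupation_le[of l UNIV n] that by (simp add: spatial_partitions_eq)
  have wnn: "0 \<le> weight V \<theta> L l / ?Z" if "l \<in> spatial_partitions n" for l
    using weight_nonneg[where l = l and X = UNIV and k = n and \<theta> = \<theta> and V = V and L = L] \<theta> that pos by (auto simp: spatial_partitions_eq)
  have emB: "emeasure ?M (B m) = ennreal (?q m)" if "m \<le> n" for m
    unfolding partition_measure_def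
  proof (rule emeasure_point_measure_has_sum)
    show "((\<lambda>l. weight V \<theta> L l / ?Z) has_sum ?q m) (B m)"
      unfolding B_def divide_inverse
      by (rule has_sum_cmult_left) (rule weight_has_sum_occupation[OF \<theta> V0 lam that])
  qed (use wnn in \<open>auto simp: B_def\<close>)
  have q_nn: "0 \<le> ?q m" for m
    using pos has_sum_nonneg[OF lam] \<theta> by (intro divide_nonneg_pos mult_nonneg_nonneg h_coeff_nonneg) auto
  have BM: "B m \<in> sets ?M" for m by (auto simp: sp B_def)
  have eq: "spatial_partitions n = (\<Union>m\<in>{..n}. B m)"
    using le by (auto simp: B_def)
  have "emeasure ?M (space ?M) = (\<Sum>m\<le>n. emeasure ?M (B m))"
    unfolding sp(1) by (subst eq, subst sum_emeasure) (use BM in \<open>auto simp: disjoint_family_on_def B_def\<close>)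
  also have "\<dots> = (\<Sum>m\<le>n. ennreal (?q m))" by (rule sum.cong) (auto simp: emB)
  also have "\<dots> = ennreal (\<Sum>m\<le>n. ?q m)" using q_nn by (rule sum_ennreal)
  also have "(\<Sum>m\<le>n. ?q m) = 1"
    using pos partition_function_eq[where \<theta> = \<theta>, OF \<theta> V0 lam]
    by (simp add: sum_divide_distrib[symmetric] del: of_nat_diff)
  finally show ps: "prob_space ?M" by (intro prob_spaceI) simp
  interpret prob_space ?M by (rule ps)
  have meB: "measure ?M (B m) = ?q m" if "m \<le> n" for m
    using emB[OF that] q_nn by (simp add: measure_def)
  have "(\<integral>l. F (occupation l 0) \<partial>?M) = (\<integral>l. (\<Sum>m\<le>n. indicator (B m) l *\<^sub>R F m) \<partial>?M)"
  proof (rule Bochner_Integration.integral_cong[OF refl])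
    fix l assume l: "l \<in> space ?M"
    then have "(\<Sum>m\<le>n. indicator (B m) l *\<^sub>R F m) = (\<Sum>m\<le>n. if m = occupation l 0 then F m else 0)"
      by (intro sum.cong) (auto simp: B_def sp)
    then show "F (occupation l 0) = (\<Sum>m\<le>n. indicator (B m) l *\<^sub>R F m)"
      using le l by (simp add: sp)
  qed
  also have "\<dots> = (\<Sum>m\<le>n. measure ?M (B m) *\<^sub>R F m)"
    using BM by (subst Bochner_Integration.integral_sum) (auto intro!: integrable_indicator simp: emeasure_eq_measure integral_indicator)
  also have "\<dots> = (\<Sum>m\<le>n. F m * of_real (?q m))"
    by (intro sum.cong) (auto simp: meB scaleR_conv_of_real)
  finally show "(\<integral>l. F (occupation l 0) \<partial>?M) = (\<Sum>m\<le>n. F m * of_real (h_coeff \<theta> (int m) * h_coeff (\<lambda>j. \<theta> j * lam j) (int (n - m)))) / of_real ?Z"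
    by (simp add: sum_divide_distrib)
qed

section \<open>Lattice sums and their continuum limit\<close>

definition floor_vec :: "real ^ 'd \<Rightarrow> int ^ 'd" where
  "floor_vec y = (\<chi> i. \<lfloor>y $ i\<rfloor>)"

lemma floor_vec_cell: "floor_vec -` {a} = (\<Inter>i\<in>UNIV. {y. y $ i \<ge> of_int (a $ i)} \<inter> {y. y $ i < of_int (a $ i) + 1})"
  by (auto simp: floor_vec_def vec_eq_iff floor_eq_iff)

lemma measurable_floor_vec: "floor_vec \<in> borel \<rightarrow>\<^sub>M count_space UNIV"
proof -
  have "(\<Inter>i\<in>UNIV. {y :: real ^ 'd. y $ i \<ge> of_int (a $ i)} \<inter> {y. y $ i < of_int (a $ i) + 1}) \<in> sets borel" for a :: "int ^ 'd"
    by (intro sets.finite_INT sets.Int borel_closed[OF closed_halfspace_component_ge_cart]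
        borel_open[OF open_halfspace_component_lt_cart]) auto
  then show ?thesis
    by (subst measurable_count_space_eq_countable) (auto simp: floor_vec_cell)
qed

lemma emeasure_floor_vec_cell: "emeasure lborel (floor_vec -` {a :: int ^ 'd}) = 1"
proof (rule antisym)
  define u :: "real ^ 'd" where "u = (\<chi> i. of_int (a $ i) + 1)"
  have basis: "(u - lattice_point a) \<bullet> b = 1" if "b \<in> Basis" for b
    using that by (auto simp: Basis_vec_def inner_axis u_def lattice_point_def)
  then have le: "\<forall>b\<in>Basis. lattice_point a \<bullet> b \<le> u \<bullet> b"
    by (metis add_le_same_cancel1 diff_add_cancel inner_diff_left le_add_same_cancel2 zero_le_one)
  have sets: "floor_vec -` {a} \<in> sets (borel :: (real ^ 'd) measure)"
    using measurable_sets[OF measurable_floor_vec, of "{a}"] by simp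
  have "emeasure lborel (floor_vec -` {a}) \<le> emeasure lborel (cbox (lattice_point a) u)"
    by (rule emeasure_mono) (auto simp: floor_vec_cell mem_box_cart lattice_point_def u_def less_imp_le)
  then show "emeasure lborel (floor_vec -` {a}) \<le> 1"
    using le basis by (simp add: emeasure_lborel_cbox_eq)
  have "emeasure lborel (box (lattice_point a) u) \<le> emeasure lborel (floor_vec -` {a})"
    by (rule emeasure_mono) (use sets in \<open>auto simp: floor_vec_cell mem_box_cart lattice_point_def u_def less_imp_le\<close>)
  then show "1 \<le> emeasure lborel (floor_vec -` {a})"
    using le basis by (simp add: emeasure_lborel_box_eq)
qed

text \<open>
  The unit cells with lower corners in the lattice tile the space and have volume 1, so that a sum over
  the lattice is the integral of a step function.
\<close>
lemma distr_floor_vec: "distr lborel (count_space UNIV) (floor_vec :: real ^ 'd \<Rightarrow> int ^ 'd) = count_space UNIV"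
proof (rule measure_eqI_countable[where A = UNIV])
  fix a :: "int ^ 'd"
  show "emeasure (distr lborel (count_space UNIV) floor_vec) {a} = emeasure (count_space UNIV) {a}"
    by (subst emeasure_distr) (auto simp: emeasure_floor_vec_cell measurable_floor_vec)
qed auto

lemma nn_integral_lattice:
  "(\<integral>\<^sup>+x. F x \<partial>count_space UNIV) = (\<integral>\<^sup>+y. F (floor_vec y) \<partial>lborel)" for F :: "int ^ 'd \<Rightarrow> ennreal"
  by (subst distr_floor_vec[symmetric]) (simp add: nn_integral_distr measurable_floor_vec)

lemma nn_integral_scaleR:
  fixes f :: "'a :: euclidean_space \<Rightarrow> ennreal"
  assumes [measurable]: "f \<in> borel_measurable borel" and c: "0 < c"
  shows "(\<integral>\<^sup>+y. f y \<partial>lborel) = ennreal (c ^ DIM('a)) * (\<integral>\<^sup>+y. f (c *\<^sub>R y) \<partial>lborel)"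
proof -
  have "(\<integral>\<^sup>+y. f y \<partial>lborel) = (\<integral>\<^sup>+y. f y \<partial>density (distr lborel borel (\<lambda>y. 0 + c *\<^sub>R y)) (\<lambda>_. \<bar>c\<bar> ^ DIM('a)))"
    using c by (subst lborel_affine[of c 0]) auto
  also have "\<dots> = ennreal (c ^ DIM('a)) * (\<integral>\<^sup>+y. f (c *\<^sub>R y) \<partial>lborel)"
    using c by (simp add: nn_integral_density nn_integral_distr nn_integral_cmult)
  finally show ?thesis .
qed

lemma dist_floor_vec: "norm (lattice_point (floor_vec y) - y) \<le> real CARD('d)" for y :: "real ^ 'd"
proof -
  have "norm (lattice_point (floor_vec y) - y) \<le> (\<Sum>i\<in>UNIV. \<bar>(lattice_point (floor_vec y) - y) $ i\<bar>)"
    by (rule norm_le_l1_cart)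
  also have "\<dots> \<le> (\<Sum>i\<in>(UNIV :: 'd set). 1)"
  proof (rule sum_mono)
    fix i :: 'd
    have "\<bar>real_of_int \<lfloor>y $ i\<rfloor> - y $ i\<bar> \<le> 1" by linarith
    then show "\<bar>(lattice_point (floor_vec y) - y) $ i\<bar> \<le> 1"
      by (simp add: lattice_point_def floor_vec_def)
  qed
  finally show ?thesis by simp
qed

lemma norm_lattice_point_ge_1: "1 \<le> norm (lattice_point x)" if "x \<noteq> 0"
proof -
  obtain i where i: "x $ i \<noteq> 0" using \<open>x \<noteq> 0\<close> by (auto simp: vec_eq_iff)
  then have "1 \<le> \<bar>of_int (x $ i) :: real\<bar>" by linarith
  also have "\<dots> = \<bar>lattice_point x $ i\<bar>" by (simp add: lattice_point_def)
  also have "\<dots> \<le> norm (lattice_point x)" by (rule component_le_norm_cart)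
  finally show ?thesis .
qed

text \<open>
  A nonzero lattice point has norm at least 1, hence the rounding error is bounded by a multiple of
  the rounded vector. This fails for the cell of the origin and is the reason why sums over \<open>x \<noteq> 0\<close>
  are comparable with integrals uniformly in the mesh.
\<close>
lemma norm_le_norm_floor_vec:
  fixes y :: "real ^ 'd"
  assumes "floor_vec y \<noteq> 0"
  shows "norm y \<le> (1 + real CARD('d)) * norm (lattice_point (floor_vec y))"
proof -
  have "norm y \<le> norm (lattice_point (floor_vec y)) + real CARD('d)"
    using dist_floor_vec[of y] norm_triangle_ineq4[of "lattice_point (floor_vec y)" "lattice_point (floor_vec y) - y"] by simp
  also have "real CARD('d) \<le> real CARD('d) * norm (lattice_point (floor_vec y))"
    using norm_lattice_point_ge_1[OF assms] by (simp add: mult_le_cancel_left1)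
  finally show ?thesis by (simp add: algebra_simps)
qed

lemma summable_power_exp_powr:
  fixes \<delta> A :: real
  assumes "0 < \<delta>" "0 < A"
  shows "summable (\<lambda>k. (real k + 1) ^ p * exp (- ((real k / A) powr \<delta>)))"
proof -
  define q where "q = real p"
  have "(\<lambda>k. (real k + 1) powr q * exp (- ((real k / A) powr \<delta>))) \<in> O(\<lambda>k. real k powr (-2))"
    using assms by real_asymp
  then have "(\<lambda>k. (real k + 1) ^ p * exp (- ((real k / A) powr \<delta>))) \<in> O(\<lambda>k. real k powr (-2))"
    by (simp add: q_def powr_realpow)
  moreover have "summable (\<lambda>k. real k powr (-2))" by (subst summable_real_powr_iff) simp
  ultimately show ?thesis
    using summable_comparison_test_bigo[of "\<lambda>k. real k powr (-2)"] by simp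
qed

text \<open>
  Cover the space by balls of radius \<open>k + 1\<close>: on the \<open>k\<close>th shell the function is at most its value at
  radius \<open>k\<close>, which decays faster than any power of the volume of the ball grows.
\<close>
lemma integrable_exp_norm_powr:
  fixes \<delta> A :: real
  assumes "0 < \<delta>" "0 < A"
  shows "integrable lborel (\<lambda>y :: 'a :: euclidean_space. exp (- ((norm y / A) powr \<delta>)))"
proof (rule integrableI_bounded)
  let ?e = "\<lambda>k. exp (- ((real k / A) powr \<delta>))"
  let ?v = "unit_ball_vol (real DIM('a))"
  have "(\<integral>\<^sup>+y. ennreal (norm (exp (- ((norm (y :: 'a) / A) powr \<delta>)))) \<partial>lborel)
     \<le> (\<integral>\<^sup>+y. (\<Sum>k. ennreal (?e k) * indicator (ball (0 :: 'a) (real k + 1)) y) \<partial>lborel)"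
  proof (rule nn_integral_mono)
    fix y :: 'a
    define k where "k = nat \<lfloor>norm y\<rfloor>"
    have k: "real k \<le> norm y" "norm y < real k + 1"
      by (auto simp: k_def)
    have "(real k / A) powr \<delta> \<le> (norm y / A) powr \<delta>"
      using k assms by (intro powr_mono2 divide_right_mono) auto
    then have "ennreal (norm (exp (- ((norm y / A) powr \<delta>)))) \<le> ennreal (?e k) * indicator (ball 0 (real k + 1)) y"
      using k by (simp add: ennreal_leI)
    also have "\<dots> \<le> (\<Sum>k. ennreal (?e k) * indicator (ball 0 (real k + 1)) y)"
      using sum_le_suminf[of "\<lambda>k. ennreal (?e k) * indicator (ball 0 (real k + 1)) y" "{k}"]
      by (simp only: sum.insert finite.emptyI finite_insert empty_iff sum.empty not_False_eq_True add_0_right summableI simp_thms zero_le)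
    finally show "ennreal (norm (exp (- ((norm y / A) powr \<delta>)))) \<le> (\<Sum>k. ennreal (?e k) * indicator (ball 0 (real k + 1)) y)" .
  qed
  also have "\<dots> = (\<Sum>k. ennreal (?e k) * emeasure lborel (ball (0 :: 'a) (real k + 1)))"
  proof (subst nn_integral_suminf)
    fix k
    have B: "ball (0 :: 'a) (real k + 1) \<in> sets lborel" by simp
    show "(\<lambda>y. ennreal (?e k) * indicator (ball (0 :: 'a) (real k + 1)) y) \<in> borel_measurable lborel"
      by (intro borel_measurable_times_ennreal borel_measurable_const borel_measurable_indicator B)
  next
    have B: "ball (0 :: 'a) (real k + 1) \<in> sets lborel" for k :: nat by simp
    show "(\<Sum>k. \<integral>\<^sup>+y. ennreal (?e k) * indicator (ball (0 :: 'a) (real k + 1)) y \<partial>lborel)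
       = (\<Sum>k. ennreal (?e k) * emeasure lborel (ball (0 :: 'a) (real k + 1)))"
      by (rule suminf_cong) (rule nn_integral_cmult_indicator[OF B])
  qed
  also have "\<dots> = (\<Sum>k. ennreal (?v * ((real k + 1) ^ DIM('a) * ?e k)))"
  proof (rule suminf_cong)
    fix k
    have "emeasure lborel (ball (0 :: 'a) (real k + 1)) = ennreal (?v * (real k + 1) ^ DIM('a))"
      by (rule emeasure_ball) simp
    then show "ennreal (?e k) * emeasure lborel (ball (0 :: 'a) (real k + 1)) = ennreal (?v * ((real k + 1) ^ DIM('a) * ?e k))"
      by (simp only: ennreal_mult''[symmetric] exp_ge_zero mult.commute mult.left_commute mult.assoc unit_ball_vol_nonneg zero_le_mult_iff zero_le_power)
         (simp add: ennreal_mult'[symmetric] mult_ac)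
  qed
  also have "\<dots> = ennreal (\<Sum>k. ?v * ((real k + 1) ^ DIM('a) * ?e k))"
    using summable_mult[OF summable_power_exp_powr[OF assms]]
    by (intro suminf_ennreal2) auto
  also have "\<dots> < \<infinity>" by simp
  finally show "(\<integral>\<^sup>+y. ennreal (norm (exp (- ((norm (y :: 'a) / A) powr \<delta>)))) \<partial>lborel) < \<infinity>" .
qed simp

text \<open>
  The step function on the mesh \<open>1 / c\<close> whose integral is \<open>c ^ - d\<close> times the sum of
  \<open>exp (- norm (x / c) powr \<delta>)\<close> over the lattice points \<open>x \<noteq> 0\<close>.
\<close>
definition cell_profile :: "real \<Rightarrow> real \<Rightarrow> real ^ 'd \<Rightarrow> real" where
  "cell_profile \<delta> c y = (if floor_vec (c *\<^sub>R y) = 0 then 0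
     else exp (- (norm (lattice_point (floor_vec (c *\<^sub>R y)) /\<^sub>R c) powr \<delta>)))"

lemma cell_profile_measurable [measurable]: "(cell_profile \<delta> c :: real ^ 'd \<Rightarrow> real) \<in> borel_measurable borel"
proof -
  define H :: "int ^ 'd \<Rightarrow> real" where "H = (\<lambda>x. if x = 0 then 0 else exp (- (norm (lattice_point x /\<^sub>R c) powr \<delta>)))"
  have "(\<lambda>y :: real ^ 'd. H (floor_vec (c *\<^sub>R y))) \<in> borel_measurable borel"
    by (rule measurable_compose[OF measurable_compose[OF _ measurable_floor_vec]]) auto
  then show ?thesis by (simp add: cell_profile_def[abs_def] H_def)
qed

lemma cell_profile_bounds:
  fixes y :: "real ^ 'd"
  assumes "0 < \<delta>" "0 < c"
  shows "0 \<le> cell_profile \<delta> c y" "cell_profile \<delta> c y \<le> exp (- ((norm y / (1 + real CARD('d))) powr \<delta>))"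
proof -
  show "0 \<le> cell_profile \<delta> c y" by (simp add: cell_profile_def)
  have "norm y / (1 + real CARD('d)) \<le> norm (lattice_point (floor_vec (c *\<^sub>R y)) /\<^sub>R c)" if "floor_vec (c *\<^sub>R y) \<noteq> 0"
    using norm_le_norm_floor_vec[OF that] assms by (simp add: field_simps)
  then show "cell_profile \<delta> c y \<le> exp (- ((norm y / (1 + real CARD('d))) powr \<delta>))"
    using assms by (auto simp: cell_profile_def intro!: powr_mono2)
qed

lemma cell_profile_integrable:
  assumes "0 < \<delta>" "0 < c"
  shows "integrable lborel (cell_profile \<delta> c :: real ^ 'd \<Rightarrow> real)"
proof (rule Bochner_Integration.integrable_bound)
  show "integrable lborel (\<lambda>y :: real ^ 'd. exp (- ((norm y / (1 + real CARD('d))) powr \<delta>)))"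
    by (rule integrable_exp_norm_powr) (use assms in auto)
  show "AE y :: real ^ 'd in lborel. norm (cell_profile \<delta> c y) \<le> norm (exp (- ((norm y / (1 + real CARD('d))) powr \<delta>)))"
    by (rule AE_I2) (metis abs_exp_cancel abs_of_nonneg cell_profile_bounds[OF assms] real_norm_def)
qed simp

text \<open>
  Integrate the step function over the cells and rescale by \<open>c\<close>.
\<close>
lemma lattice_sum:
  assumes "0 < \<delta>" "0 < c"
  shows "((\<lambda>x :: int ^ 'd. exp (- (norm (lattice_point x /\<^sub>R c) powr \<delta>))) has_sum
     (c ^ CARD('d) * (\<integral>y. cell_profile \<delta> c (y :: real ^ 'd) \<partial>lborel))) (- {0})"
proof -
  let ?f = "\<lambda>x :: int ^ 'd. exp (- (norm (lattice_point x /\<^sub>R c) powr \<delta>))"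
  let ?I = "\<integral>y. cell_profile \<delta> c (y :: real ^ 'd) \<partial>lborel"
  note int = cell_profile_integrable[OF assms, where 'd = 'd]
  have "(\<integral>\<^sup>+x. ennreal (?f x) \<partial>count_space (- {0})) = (\<integral>\<^sup>+x. ennreal (?f x) * indicator (- {0}) x \<partial>count_space UNIV)"
    by (rule nn_integral_count_space_indicator) simp
  also have "\<dots> = (\<integral>\<^sup>+y. ennreal (?f (floor_vec y)) * indicator (- {0}) (floor_vec y) \<partial>(lborel :: (real ^ 'd) measure))"
    by (rule nn_integral_lattice)
  also have "\<dots> = ennreal (c ^ DIM(real ^ 'd)) * (\<integral>\<^sup>+y. ennreal (?f (floor_vec (c *\<^sub>R y))) * indicator (- {0}) (floor_vec (c *\<^sub>R y)) \<partial>(lborel :: (real ^ 'd) measure))"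
    by (rule nn_integral_scaleR[OF _ assms(2)], rule measurable_compose[OF measurable_floor_vec]) auto
  also have "(\<integral>\<^sup>+y. ennreal (?f (floor_vec (c *\<^sub>R y))) * indicator (- {0}) (floor_vec (c *\<^sub>R y)) \<partial>(lborel :: (real ^ 'd) measure))
     = (\<integral>\<^sup>+y. ennreal (cell_profile \<delta> c (y :: real ^ 'd)) \<partial>lborel)"
    by (rule nn_integral_cong) (auto simp: cell_profile_def)
  also have "\<dots> = ennreal ?I"
    by (rule nn_integral_eq_integral[OF int]) (use cell_profile_bounds[OF assms, where 'd = 'd] in auto)
  also have "ennreal (c ^ DIM(real ^ 'd)) * ennreal ?I = ennreal (c ^ CARD('d) * ?I)"
    using assms by (simp add: ennreal_mult')
  finally have eq: "(\<integral>\<^sup>+x. ennreal (?f x) \<partial>count_space (- {0})) = ennreal (c ^ CARD('d) * ?I)" .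
  have abs: "Infinite_Set_Sum.abs_summable_on ?f (- {0})"
    unfolding Infinite_Set_Sum.abs_summable_on_def by (rule integrableI_bounded) (use eq in simp_all)
  have I0: "0 \<le> ?I" using cell_profile_bounds[OF assms, where 'd = 'd] by (intro Bochner_Integration.integral_nonneg) auto
  have "infsetsum ?f (- {0}) = c ^ CARD('d) * ?I"
    using eq nn_integral_conv_infsetsum[OF abs] infsetsum_nonneg[of "- {0}" ?f] I0 assms by auto
  moreover have "?f summable_on (- {0})"
    using abs_summable_equivalent[THEN iffD2, OF abs] by (rule abs_summable_summable)
  ultimately show ?thesis using infsetsum_infsum[OF abs] by (simp add: has_sum_infsum)
qed

lemma cell_profile_integral_bounds:
  assumes "0 < \<delta>" "0 < c"
  shows "(\<integral>y. cell_profile \<delta> c (y :: real ^ 'd) \<partial>lborel) \<le> (\<integral>y. exp (- ((norm (y :: real ^ 'd) / (1 + real CARD('d))) powr \<delta>)) \<partial>lborel)"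
    and "0 \<le> (\<integral>y. cell_profile \<delta> c (y :: real ^ 'd) \<partial>lborel)"
proof -
  have i: "integrable lborel (\<lambda>y :: real ^ 'd. exp (- ((norm y / (1 + real CARD('d))) powr \<delta>)))"
    by (rule integrable_exp_norm_powr) (use assms in auto)
  show "(\<integral>y. cell_profile \<delta> c (y :: real ^ 'd) \<partial>lborel) \<le> (\<integral>y. exp (- ((norm (y :: real ^ 'd) / (1 + real CARD('d))) powr \<delta>)) \<partial>lborel)"
    by (rule integral_mono[OF cell_profile_integrable[OF assms] i]) (rule cell_profile_bounds[OF assms])
  show "0 \<le> (\<integral>y. cell_profile \<delta> c (y :: real ^ 'd) \<partial>lborel)"
    by (rule Bochner_Integration.integral_nonneg) (rule cell_profile_bounds[OF assms])
qed

text \<open>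
  Dominated convergence, with the dominating function of \<open>cell_profile_bounds\<close>. The cell of the origin,
  on which \<open>cell_profile\<close> vanishes, shrinks to a point.
\<close>
lemma cell_profile_integral_tendsto:
  assumes \<delta>: "0 < \<delta>"
  shows "((\<lambda>c. \<integral>y. cell_profile \<delta> c (y :: real ^ 'd) \<partial>lborel) \<longlongrightarrow> (\<integral>y. exp (- (norm (y :: real ^ 'd) powr \<delta>)) \<partial>lborel)) at_top"
proof (rule integral_dominated_convergence_at_top[where w = "\<lambda>y. exp (- ((norm y / (1 + real CARD('d))) powr \<delta>))"])
  show "integrable lborel (\<lambda>y :: real ^ 'd. exp (- ((norm y / (1 + real CARD('d))) powr \<delta>)))"
    by (rule integrable_exp_norm_powr) (use \<delta> in auto)
  show "\<forall>\<^sub>F c in at_top. AE y :: real ^ 'd in lborel. norm (cell_profile \<delta> c y) \<le> exp (- ((norm y / (1 + real CARD('d))) powr \<delta>))"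
    using eventually_gt_at_top[of 0] by eventually_elim (use cell_profile_bounds[OF \<delta>, where 'd = 'd] in auto)
  show "AE y :: real ^ 'd in lborel. ((\<lambda>c. cell_profile \<delta> c y) \<longlongrightarrow> exp (- (norm y powr \<delta>))) at_top"
    using AE_lborel_singleton[of 0]
  proof eventually_elim
    case (elim y)
    let ?d = "real CARD('d)"
    have dist: "norm (lattice_point (floor_vec (c *\<^sub>R y)) /\<^sub>R c - y) \<le> ?d / c" if "0 < c" for c
    proof -
      have "lattice_point (floor_vec (c *\<^sub>R y)) /\<^sub>R c - y = (lattice_point (floor_vec (c *\<^sub>R y)) - c *\<^sub>R y) /\<^sub>R c"
        using that by (simp add: algebra_simps)
      also have "norm \<dots> = norm (lattice_point (floor_vec (c *\<^sub>R y)) - c *\<^sub>R y) / c"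
        using that by (simp add: divide_inverse mult.commute)
      also have "\<dots> \<le> ?d / c" using dist_floor_vec that by (intro divide_right_mono) auto
      finally show ?thesis .
    qed
    have "((\<lambda>c. lattice_point (floor_vec (c *\<^sub>R y)) /\<^sub>R c - y) \<longlongrightarrow> 0) at_top"
    proof (rule tendsto_norm_zero_cancel, rule tendsto_sandwich[where f = "\<lambda>_. 0" and h = "\<lambda>c. ?d / c"])
      show "((\<lambda>c. ?d / c) \<longlongrightarrow> 0) at_top" by real_asymp
      show "\<forall>\<^sub>F c in at_top. norm (lattice_point (floor_vec (c *\<^sub>R y)) /\<^sub>R c - y) \<le> ?d / c"
        using eventually_gt_at_top[of 0] by eventually_elim (rule dist)
    qed auto
    then have lim: "((\<lambda>c. lattice_point (floor_vec (c *\<^sub>R y)) /\<^sub>R c) \<longlongrightarrow> y) at_top"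
      by (simp add: LIM_zero_iff)
    have "((\<lambda>c. exp (- (norm (lattice_point (floor_vec (c *\<^sub>R y)) /\<^sub>R c) powr \<delta>))) \<longlongrightarrow> exp (- (norm y powr \<delta>))) at_top"
      by (intro tendsto_exp tendsto_minus tendsto_powr tendsto_norm lim tendsto_const) (use elim in auto)
    moreover have "\<forall>\<^sub>F c in at_top. exp (- (norm (lattice_point (floor_vec (c *\<^sub>R y)) /\<^sub>R c) powr \<delta>)) = cell_profile \<delta> c y"
      using eventually_gt_at_top[of "max 0 (?d / norm y)"]
    proof eventually_elim
      case c: (elim c)
      have "floor_vec (c *\<^sub>R y) \<noteq> 0"
      proof
        assume "floor_vec (c *\<^sub>R y) = 0"
        then have "norm (c *\<^sub>R y) \<le> ?d"
          using dist_floor_vec[of "c *\<^sub>R y"] by (simp add: lattice_point_def vec_eq_iff[of _ 0] zero_vec_def[symmetric])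
        then show False using c elim by (simp add: field_simps)
      qed
      then show ?case by (simp add: cell_profile_def)
    qed
    ultimately show ?case by (rule Lim_transform_eventually)
  qed
qed auto

text \<open>
  Substitute \<open>y = s powr (- 1 / \<delta>) * u\<close>.
\<close>
lemma integral_exp_powr_scale:
  assumes \<delta>: "0 < \<delta>" and s: "0 < s"
  shows "(\<integral>y. exp (- s * norm (y :: real ^ 'd) powr \<delta>) \<partial>lborel)
     = s powr (- real CARD('d) / \<delta>) * (\<integral>y. exp (- (norm (y :: real ^ 'd) powr \<delta>)) \<partial>lborel)"
proof -
  define c where "c = s powr (- 1 / \<delta>)"
  have c: "0 < c" using s by (simp add: c_def)
  have cd: "c ^ CARD('d) = s powr (- real CARD('d) / \<delta>)"
    using s by (simp add: c_def powr_powr powr_realpow[symmetric])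
  have "s * norm (c *\<^sub>R y) powr \<delta> = norm y powr \<delta>" for y :: "real ^ 'd"
  proof -
    have "c powr \<delta> = s powr (- 1 / \<delta> * \<delta>)" by (simp only: c_def powr_powr)
    then have "s * c powr \<delta> = 1" using s \<delta> by (simp add: powr_minus)
    then show ?thesis using c by (simp add: powr_mult mult.assoc[symmetric])
  qed
  then have "(\<integral>\<^sup>+y. ennreal (exp (- s * norm (y :: real ^ 'd) powr \<delta>)) \<partial>lborel)
     = ennreal (s powr (- real CARD('d) / \<delta>)) * (\<integral>\<^sup>+y. ennreal (exp (- (norm (y :: real ^ 'd) powr \<delta>))) \<partial>lborel)"
    by (subst nn_integral_scaleR[OF _ c]) (auto simp: cd)
  then show ?thesis
    by (simp add: integral_eq_nn_integral enn2real_mult)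
qed

lemma integral_exp_powr_pos:
  assumes \<delta>: "0 < \<delta>"
  shows "0 < (\<integral>y. exp (- (norm (y :: real ^ 'd) powr \<delta>)) \<partial>lborel)"
proof -
  have i: "integrable lborel (\<lambda>y :: real ^ 'd. exp (- (norm y powr \<delta>)))"
    using integrable_exp_norm_powr[OF \<delta>, of 1] by simp
  have "(\<integral>y. exp (- (norm (y :: real ^ 'd) powr \<delta>)) \<partial>lborel) \<noteq> 0"
    using integral_nonneg_eq_0_iff_AE[OF i] by (auto simp: AE_iff_null null_sets_def)
  moreover have "0 \<le> (\<integral>y. exp (- (norm (y :: real ^ 'd) powr \<delta>)) \<partial>lborel)" by (intro Bochner_Integration.integral_nonneg) auto
  ultimately show ?thesis by linarith
qed

section \<open>Centred compound Poisson laws\<close>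

lemma exp_remainder_bounds:
  fixes x :: real
  shows "0 \<le> exp x - 1 - x" "exp x - 1 - x \<le> x\<^sup>2 / 2 * exp \<bar>x\<bar>"
proof -
  show "0 \<le> exp x - 1 - x" using exp_ge_add_one_self[of x] by linarith
  obtain t where t: "\<bar>t\<bar> \<le> \<bar>x\<bar>" "exp x = (\<Sum>m<2. x ^ m / fact m) + exp t / fact 2 * x ^ 2"
    using Maclaurin_exp_le[of x 2] by blast
  have "exp x - 1 - x = x\<^sup>2 / 2 * exp t" using t(2) by (simp add: numeral_2_eq_2)
  also have "\<dots> \<le> x\<^sup>2 / 2 * exp \<bar>x\<bar>" using t(1) by (intro mult_left_mono) auto
  finally show "exp x - 1 - x \<le> x\<^sup>2 / 2 * exp \<bar>x\<bar>" .
qed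

lemma compound_poisson_nonneg: "(\<And>j. 0 \<le> \<phi> j) \<Longrightarrow> 0 \<le> compound_poisson \<phi> k"
  by (simp add: compound_poisson_def h_coeff_nonneg)

text \<open>
  The exponent is \<open>\<Sum>j. \<phi> j / j * (exp (t * j) - 1 - t * j)\<close>, whose terms are at most
  \<open>t\<^sup>2 / 2 * j * \<phi> j * exp (j * \<tau>)\<close>. Here \<open>v\<close> is the volume, and \<open>\<tau>\<close> is an exponential rate that the
  jump intensities can absorb at the cost of a constant factor in their bound.
\<close>
lemma compound_poisson_exp_moment:
  fixes t \<tau> v :: real
  assumes pos: "\<And>j. 0 \<le> \<phi> j" and zero: "\<phi> 0 = 0" and t: "\<bar>t\<bar> \<le> \<tau>"
    and bound: "\<And>j. \<phi> j * exp (real j * \<tau>) \<le> v * M j" and sM: "summable (\<lambda>j. real j * M j)"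
  shows "summable (\<lambda>k. compound_poisson \<phi> k * exp (t * (real k - suminf \<phi>)))"
    and "(\<Sum>k. compound_poisson \<phi> k * exp (t * (real k - suminf \<phi>))) \<le> exp (t\<^sup>2 * v * (\<Sum>j. real j * M j) / 2)"
    and "summable \<phi>" "summable (\<lambda>j. \<phi> j / real j)"
proof -
  have M1: "\<phi> j * exp (real j * \<tau>) / real j \<le> v * (real j * M j)" for j
  proof (cases "j = 0")
    case False
    have "1 * 1 \<le> real j * real j" using False by (intro mult_mono) auto
    then have "\<phi> j * exp (real j * \<tau>) / real j \<le> \<phi> j * exp (real j * \<tau>) * real j"
      using mult_left_mono[of "1 / real j" "real j" "\<phi> j * exp (real j * \<tau>)"] pos[of j] False by (simp add: field_simps)
    also have "\<dots> \<le> v * M j * real j" by (rule mult_right_mono[OF bound]) simp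
    finally show ?thesis by (simp add: mult_ac)
  qed simp
  have M2: "\<phi> j * exp (real j * \<tau>) * real j \<le> v * (real j * M j)" for j
    using mult_right_mono[OF bound[of j], of "real j"] by (simp add: mult_ac)
  have sv: "summable (\<lambda>j. v * (real j * M j))" by (rule summable_mult[OF sM])
  have \<tau>: "0 \<le> \<tau>" using t by linarith
  have e1: "1 \<le> exp (real j * \<tau>)" for j using \<tau> by simp
  have smt: "summable (\<lambda>j. \<phi> j / real j * exp (real j * u))" if "u \<le> \<tau>" for u
  proof (rule summable_comparison_test'[OF sv, of 0])
    fix j
    have "\<phi> j / real j * exp (real j * u) \<le> \<phi> j / real j * exp (real j * \<tau>)"
      using that pos[of j] by (intro mult_left_mono) (auto intro!: mult_left_mono)
    then show "norm (\<phi> j / real j * exp (real j * u)) \<le> v * (real j * M j)"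
      using M1[of j] pos[of j] by simp
  qed
  show s1: "summable \<phi>"
  proof (rule summable_comparison_test'[OF sv, of 1])
    fix j :: nat assume j: "1 \<le> j"
    have "\<phi> j * 1 * 1 \<le> \<phi> j * exp (real j * \<tau>) * real j"
      using j pos[of j] e1[of j] by (intro mult_mono) auto
    then show "norm (\<phi> j) \<le> v * (real j * M j)" using M2[of j] pos[of j] by simp
  qed
  show "summable (\<lambda>j. \<phi> j / real j)" using smt[of 0] \<tau> by simp
  have rem: "\<phi> j / real j * (exp (t * real j) - 1 - t * real j) \<le> t\<^sup>2 * v / 2 * (real j * M j)"
    and rem0: "0 \<le> \<phi> j / real j * (exp (t * real j) - 1 - t * real j)" for j
  proof -
    have "\<bar>t * real j\<bar> \<le> real j * \<tau>"
      using mult_right_mono[OF t, of "real j"] by (simp add: abs_mult mult.commute)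
    then have "exp (t * real j) - 1 - t * real j \<le> (t * real j)\<^sup>2 / 2 * exp (real j * \<tau>)"
      using exp_remainder_bounds(2)[of "t * real j"] by (elim order.trans) (auto intro!: mult_left_mono)
    then have "\<phi> j / real j * (exp (t * real j) - 1 - t * real j) \<le> \<phi> j / real j * ((t * real j)\<^sup>2 / 2 * exp (real j * \<tau>))"
      using pos[of j] by (intro mult_left_mono) auto
    also have "\<dots> = t\<^sup>2 / 2 * (\<phi> j * exp (real j * \<tau>) * real j)"
      by (simp add: power2_eq_square)
    also have "\<dots> \<le> t\<^sup>2 / 2 * (v * (real j * M j))" by (intro mult_left_mono M2) auto
    finally show "\<phi> j / real j * (exp (t * real j) - 1 - t * real j) \<le> t\<^sup>2 * v / 2 * (real j * M j)"
      by (simp add: mult_ac)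
    show "0 \<le> \<phi> j / real j * (exp (t * real j) - 1 - t * real j)"
      using pos[of j] exp_remainder_bounds(1)[of "t * real j"] by (intro mult_nonneg_nonneg) auto
  qed
  define R where "R = (\<Sum>j. \<phi> j / real j * (exp (t * real j) - 1 - t * real j))"
  have sr: "summable (\<lambda>j. \<phi> j / real j * (exp (t * real j) - 1 - t * real j))"
    by (rule summable_comparison_test'[OF summable_mult[OF sM, of "t\<^sup>2 * v / 2"], of 0])
       (use rem rem0 in \<open>simp del: times_divide_eq_left times_divide_eq_right\<close>)
  have "R \<le> (\<Sum>j. t\<^sup>2 * v / 2 * (real j * M j))"
    unfolding R_def by (rule suminf_le[OF rem sr summable_mult[OF sM]])
  also have "\<dots> = t\<^sup>2 * v * (\<Sum>j. real j * M j) / 2"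
    using suminf_mult[OF sM, of "t\<^sup>2 * v / 2"] by simp
  finally have R: "R \<le> t\<^sup>2 * v * (\<Sum>j. real j * M j) / 2" .
  have "(\<lambda>k. of_real (compound_poisson \<phi> k) * exp (of_real t * of_real (real k - suminf \<phi>))) sums
     exp (\<Sum>j. of_real (\<phi> j / real j) * (exp (complex_of_real t * of_nat j) - 1 - of_real t * of_nat j))"
    by (rule compound_poisson_transform[OF pos zero _ s1]) (use smt[of "max 0 t"] abs_le_D1[OF t] \<tau> in auto)
  also have "(\<lambda>k. complex_of_real (compound_poisson \<phi> k) * exp (of_real t * of_real (real k - suminf \<phi>)))
     = (\<lambda>k. of_real (compound_poisson \<phi> k * exp (t * (real k - suminf \<phi>))))"
    by (simp add: exp_of_real[symmetric])
  also have "(\<lambda>j. of_real (\<phi> j / real j) * (exp (complex_of_real t * of_nat j) - 1 - of_real t * of_nat j))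
     = (\<lambda>j. of_real (\<phi> j / real j * (exp (t * real j) - 1 - t * real j)))"
    by (simp add: exp_of_real[symmetric])
  also have "(\<Sum>j. complex_of_real (\<phi> j / real j * (exp (t * real j) - 1 - t * real j))) = of_real R"
    unfolding R_def by (rule suminf_of_real[OF sr, symmetric])
  also have "exp (complex_of_real R) = of_real (exp R)" by (rule exp_of_real)
  finally have S: "(\<lambda>k. compound_poisson \<phi> k * exp (t * (real k - suminf \<phi>))) sums exp R"
    by (simp only: sums_of_real_iff)
  show "summable (\<lambda>k. compound_poisson \<phi> k * exp (t * (real k - suminf \<phi>)))"
    using S by (rule sums_summable)
  show "(\<Sum>k. compound_poisson \<phi> k * exp (t * (real k - suminf \<phi>))) \<le> exp (t\<^sup>2 * v * (\<Sum>j. real j * M j) / 2)"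
    unfolding sums_unique[OF S, symmetric] using R by (simp only: exp_le_cancel_iff)
qed

text \<open>
  Markov's inequality for \<open>exp (\<tau> * (K - \<mu>)) + exp (- \<tau> * (K - \<mu>))\<close>.
\<close>
lemma compound_poisson_chernoff:
  fixes \<tau> v D :: real
  assumes pos: "\<And>j. 0 \<le> \<phi> j" and zero: "\<phi> 0 = 0" and \<tau>: "0 \<le> \<tau>"
    and bound: "\<And>j. \<phi> j * exp (real j * \<tau>) \<le> v * M j" and sM: "summable (\<lambda>j. real j * M j)"
  shows "summable (\<lambda>k. compound_poisson \<phi> k * of_bool (D < \<bar>real k - suminf \<phi>\<bar>))"
    and "(\<Sum>k. compound_poisson \<phi> k * of_bool (D < \<bar>real k - suminf \<phi>\<bar>))
       \<le> 2 * exp (\<tau>\<^sup>2 * v * (\<Sum>j. real j * M j) / 2 - \<tau> * D)"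
proof -
  let ?p = "compound_poisson \<phi>" and ?e = "\<lambda>t k. compound_poisson \<phi> k * exp (t * (real k - suminf \<phi>))"
  have "\<bar>\<tau>\<bar> \<le> \<tau>" "\<bar>- \<tau>\<bar> \<le> \<tau>" using \<tau> by auto
  note m = compound_poisson_exp_moment[OF pos zero this(1) bound sM] compound_poisson_exp_moment[OF pos zero this(2) bound sM]
  have p: "0 \<le> ?p k" for k using pos by (rule compound_poisson_nonneg)
  have le: "?p k * of_bool (D < \<bar>real k - suminf \<phi>\<bar>) \<le> exp (- (\<tau> * D)) * (?e \<tau> k + ?e (- \<tau>) k)" for k
  proof (cases "D < \<bar>real k - suminf \<phi>\<bar>")
    case True
    let ?x = "real k - suminf \<phi>"
    have "\<tau> * D \<le> \<tau> * \<bar>?x\<bar>" using True \<tau> by (intro mult_left_mono) auto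
    then have "1 \<le> exp (- (\<tau> * D)) * exp (\<tau> * \<bar>?x\<bar>)" by (simp add: exp_add[symmetric])
    also have "\<dots> \<le> exp (- (\<tau> * D)) * (exp (\<tau> * ?x) + exp (- \<tau> * ?x))"
      by (intro mult_left_mono) (auto simp: abs_if algebra_simps)
    finally have "?p k * 1 \<le> ?p k * (exp (- (\<tau> * D)) * (exp (\<tau> * ?x) + exp (- \<tau> * ?x)))"
      by (rule mult_left_mono[OF _ p])
    then show ?thesis using True by (simp add: algebra_simps)
  next
    case False
    then show ?thesis using p[of k] by (simp add: add_nonneg_nonneg)
  qed
  have sm: "summable (\<lambda>k. exp (- (\<tau> * D)) * (?e \<tau> k + ?e (- \<tau>) k))"
    by (intro summable_mult summable_add m)
  show s: "summable (\<lambda>k. ?p k * of_bool (D < \<bar>real k - suminf \<phi>\<bar>))"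
    by (rule summable_comparison_test'[OF sm, of 0]) (use le p in auto)
  have "(\<Sum>k. ?p k * of_bool (D < \<bar>real k - suminf \<phi>\<bar>)) \<le> (\<Sum>k. exp (- (\<tau> * D)) * (?e \<tau> k + ?e (- \<tau>) k))"
    by (rule suminf_le[OF le s sm])
  also have "\<dots> = exp (- (\<tau> * D)) * (suminf (?e \<tau>) + suminf (?e (- \<tau>)))"
    by (subst suminf_mult[OF summable_add[OF m(1) m(5)]]) (simp only: suminf_add[OF m(1) m(5)])
  also have "\<dots> \<le> exp (- (\<tau> * D)) * (2 * exp (\<tau>\<^sup>2 * v * (\<Sum>j. real j * M j) / 2))"
    using m(2,6) by (intro mult_left_mono) auto
  also have "\<dots> = 2 * exp (\<tau>\<^sup>2 * v * (\<Sum>j. real j * M j) / 2 - \<tau> * D)"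
    using exp_add[of "- (\<tau> * D)" "\<tau>\<^sup>2 * v * (\<Sum>j. real j * M j) / 2"] by (simp only: mult.left_commute) (simp add: algebra_simps)
  finally show "(\<Sum>k. ?p k * of_bool (D < \<bar>real k - suminf \<phi>\<bar>)) \<le> 2 * exp (\<tau>\<^sup>2 * v * (\<Sum>j. real j * M j) / 2 - \<tau> * D)" .
qed

text \<open>
  Tannery's theorem, dominated by \<open>j * M j\<close>, which is at least \<open>M j\<close> for \<open>j \<ge> 1\<close>.
\<close>
lemma compound_poisson_mean_tendsto:
  fixes \<phi> :: "nat \<Rightarrow> nat \<Rightarrow> real"
  assumes pos: "\<And>k j. 0 \<le> \<phi> k j" and zero: "\<And>k. \<phi> k 0 = 0" and v: "\<And>k. 0 < v k"
    and bound: "\<And>k j. \<phi> k j \<le> v k * M j" and sM: "summable (\<lambda>j. real j * M j)"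
    and lim: "\<And>j. (\<lambda>k. \<phi> k j / v k) \<longlonglongrightarrow> m j"
  shows "(\<lambda>k. suminf (\<phi> k) / v k) \<longlonglongrightarrow> suminf m"
proof -
  have b: "norm (\<phi> k j / v k) \<le> real j * M j" for k j
  proof (cases "j = 0")
    case False
    have M0: "0 \<le> M j" using order.trans[OF pos bound, of k j] v[of k] by (simp add: zero_le_mult_iff)
    have "\<phi> k j / v k \<le> M j" using bound[of k j] v[of k] by (simp add: field_simps)
    also have "\<dots> \<le> real j * M j" using False M0 by (simp add: mult_le_cancel_right1)
    finally show ?thesis using pos v[of k] by simp
  qed (simp add: zero)
  have sm: "summable (\<phi> k)" for k
  proof -
    have "summable (\<lambda>j. \<phi> k j / v k)" by (rule summable_comparison_test'[OF sM, of 0]) (rule b)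
    from summable_mult[OF this, of "v k"] show ?thesis using v[of k] by simp
  qed
  have "(\<lambda>k. \<Sum>j. \<phi> k j / v k) \<longlonglongrightarrow> suminf m"
    by (rule tannerys_theorem[where M = "\<lambda>j. real j * M j", OF lim _ sM, THEN conjunct2, THEN conjunct2])
       (intro always_eventually allI, use b in auto)
  then show ?thesis by (simp add: suminf_divide[OF sm])
qed

text \<open>
  In the exponent of the characteristic function at \<open>t / s\<close>, the \<open>j\<close>th term tends to
  \<open>- t\<^sup>2 / 2 * (j * m j) / \<sigma>\<^sup>2\<close> and is dominated by a constant times \<open>j * M j\<close>; the limits add up to
  \<open>- t\<^sup>2 / 2\<close> by the choice of \<open>\<sigma>\<^sup>2\<close>.
\<close>
lemma compound_poisson_clt:
  fixes \<phi> :: "nat \<Rightarrow> nat \<Rightarrow> real" and t :: real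
  assumes pos: "\<And>k j. 0 \<le> \<phi> k j" and zero: "\<And>k. \<phi> k 0 = 0" and v: "\<And>k. 0 < v k"
    and v_lim: "filterlim v at_top sequentially"
    and bound: "\<And>k j. \<phi> k j \<le> v k * M j" and sM: "summable (\<lambda>j. real j * M j)"
    and lim: "\<And>j. (\<lambda>k. \<phi> k j / v k) \<longlonglongrightarrow> m j"
    and \<sigma>: "0 < (\<Sum>j. real j * m j)"
  shows "(\<lambda>k. \<Sum>i. of_real (compound_poisson (\<phi> k) i) *
       iexp (t / sqrt ((\<Sum>j. real j * m j) * v k) * (real i - suminf (\<phi> k)))) \<longlonglongrightarrow> of_real (exp (- (t\<^sup>2 / 2)))"
proof -
  define \<sigma>2 where "\<sigma>2 = (\<Sum>j. real j * m j)"
  define s where "s = (\<lambda>k. sqrt (\<sigma>2 * v k))"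
  have \<sigma>2: "0 < \<sigma>2" using \<sigma> by (simp add: \<sigma>2_def)
  have s: "0 < s k" "s k ^ 2 = \<sigma>2 * v k" for k using \<sigma>2 v[of k] by (auto simp: s_def)
  define a where "a = (\<lambda>j k. complex_of_real (\<phi> k j / real j) * (iexp (t / s k * real j) - 1 - \<i> * of_real (t / s k * real j)))"
  have b0: "\<phi> k j * exp (real j * 0) \<le> v k * M j" for k j using bound by simp
  have sums: "(\<lambda>i. of_real (compound_poisson (\<phi> k) i) * iexp (t / s k * (real i - suminf (\<phi> k)))) sums exp (\<Sum>j. a j k)" for k
  proof -
    note m = compound_poisson_exp_moment[where \<phi> = "\<phi> k" and t = 0, OF pos zero _ b0 sM]
    have "(\<lambda>i. of_real (compound_poisson (\<phi> k) i) * exp (\<i> * of_real (t / s k) * of_real (real i - suminf (\<phi> k)))) sums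
      exp (\<Sum>j. of_real (\<phi> k j / real j) * (exp (\<i> * of_real (t / s k) * of_nat j) - 1 - \<i> * of_real (t / s k) * of_nat j))"
      by (rule compound_poisson_transform[where \<phi> = "\<phi> k", OF pos zero]) (use m(3,4) in auto)
    then show ?thesis by (simp add: a_def mult.assoc)
  qed
  have s_lim: "filterlim s at_top sequentially"
    unfolding s_def by (intro filterlim_compose[OF sqrt_at_top] filterlim_tendsto_pos_mult_at_top[OF tendsto_const \<sigma>2] v_lim)
  have x_lim: "(\<lambda>k. t / s k * real j) \<longlonglongrightarrow> 0" for j
    using tendsto_mult_left_zero[OF tendsto_divide_0[OF tendsto_const filterlim_at_top_imp_at_infinity[OF s_lim]], of t "real j"] by simp
  have vx: "v k * (t / s k * real j)\<^sup>2 = t\<^sup>2 * (real j)\<^sup>2 / \<sigma>2" for k j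
    using s(2)[of k] v[of k] \<sigma>2 by (simp add: power_mult_distrib power_divide)
  have a_bound: "norm (a j k) \<le> t\<^sup>2 / (2 * \<sigma>2) * (real j * M j)" for j k
  proof (cases "j = 0")
    case False
    let ?x = "t / s k * real j"
    have "norm (iexp ?x - 1 - \<i> * of_real ?x) \<le> ?x\<^sup>2 / 2"
      using iexp_approx1[of ?x 1] by (simp add: numeral_2_eq_2 algebra_simps)
    moreover have "norm (complex_of_real (\<phi> k j / real j)) = \<phi> k j / real j"
      using pos[of k j] by (simp only: norm_of_real abs_of_nonneg divide_nonneg_nonneg of_nat_0_le_iff)
    ultimately have "norm (a j k) \<le> \<phi> k j / real j * (?x\<^sup>2 / 2)"
      unfolding a_def norm_mult using pos[of k j] by (simp add: mult_left_mono del: times_divide_eq_left times_divide_eq_right)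
    also have "\<dots> \<le> v k * M j / real j * (?x\<^sup>2 / 2)"
      using bound[of k j] by (intro mult_right_mono divide_right_mono) auto
    also have "\<dots> = M j / (2 * real j) * (v k * ?x\<^sup>2)" by (simp add: mult_ac)
    also have "\<dots> = t\<^sup>2 / (2 * \<sigma>2) * (real j * M j)"
      unfolding vx using False by (simp add: power2_eq_square)
    finally show ?thesis .
  qed (simp add: a_def)
  have a_lim: "(\<lambda>k. a j k) \<longlonglongrightarrow> of_real (- (t\<^sup>2 / (2 * \<sigma>2) * (real j * m j)))" for j
  proof (cases "j = 0")
    case False
    let ?x = "\<lambda>k. t / s k * real j"
    define r where "r = (\<lambda>k. complex_of_real (v k) * (iexp (?x k) - 1 - \<i> * of_real (?x k)))"
    have expand: "u * (w - 1 - \<i> * y) + u * y\<^sup>2 / 2 = u * (w - (1 + \<i> * y + (\<i> * y)\<^sup>2 / 2))" for u w y :: complex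
      by (simp add: power_mult_distrib algebra_simps)
    have "norm (r k - of_real (- (t\<^sup>2 * (real j)\<^sup>2 / (2 * \<sigma>2)))) \<le> t\<^sup>2 * (real j)\<^sup>2 / \<sigma>2 * \<bar>?x k\<bar> / 6" for k
    proof -
      have "r k - of_real (- (t\<^sup>2 * (real j)\<^sup>2 / (2 * \<sigma>2))) = r k + of_real (v k * (?x k)\<^sup>2 / 2)"
        unfolding vx by simp
      also have "\<dots> = of_real (v k) * (iexp (?x k) - (1 + \<i> * of_real (?x k) + (\<i> * of_real (?x k))\<^sup>2 / 2))"
        using expand[of "of_real (v k)" "iexp (?x k)" "of_real (?x k)"]
        by (simp only: r_def of_real_mult of_real_divide of_real_power of_real_numeral)
      also have "norm \<dots> \<le> v k * (\<bar>?x k\<bar> ^ 3 / 6)"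
        unfolding norm_mult using iexp_approx1[of "?x k" 2] v[of k]
        by (intro mult_mono) (auto simp: numeral_2_eq_2 numeral_3_eq_3)
      also have "\<dots> = v k * (?x k)\<^sup>2 * \<bar>?x k\<bar> / 6"
        by (simp add: power3_eq_cube power2_eq_square abs_mult)
      finally show ?thesis unfolding vx .
    qed
    moreover have "(\<lambda>k. t\<^sup>2 * (real j)\<^sup>2 / \<sigma>2 * \<bar>?x k\<bar> / 6) \<longlonglongrightarrow> 0"
      using tendsto_mult_right_zero[OF tendsto_rabs_zero[OF x_lim[of j]], of "t\<^sup>2 * (real j)\<^sup>2 / \<sigma>2 / 6"] by (simp add: mult_ac)
    ultimately have "(\<lambda>k. r k - of_real (- (t\<^sup>2 * (real j)\<^sup>2 / (2 * \<sigma>2)))) \<longlonglongrightarrow> 0"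
      by (rule Lim_null_comparison[OF always_eventually[OF allI]])
    then have r_lim: "r \<longlonglongrightarrow> of_real (- (t\<^sup>2 * (real j)\<^sup>2 / (2 * \<sigma>2)))" by (rule LIM_zero_cancel)
    have "(\<lambda>k. of_real (\<phi> k j / v k / real j) * r k) \<longlonglongrightarrow> of_real (m j / real j) * of_real (- (t\<^sup>2 * (real j)\<^sup>2 / (2 * \<sigma>2)))"
      by (intro tendsto_mult r_lim tendsto_of_real tendsto_divide lim tendsto_const) (use False in auto)
    also have "(\<lambda>k. of_real (\<phi> k j / v k / real j) * r k) = a j"
      using v by (auto simp: fun_eq_iff a_def r_def less_imp_neq[THEN not_sym])
    also have "complex_of_real (m j / real j) * of_real (- (t\<^sup>2 * (real j)\<^sup>2 / (2 * \<sigma>2))) = of_real (- (t\<^sup>2 / (2 * \<sigma>2) * (real j * m j)))"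
      unfolding of_real_mult[symmetric] using False by (simp add: power2_eq_square)
    finally show ?thesis .
  qed (simp add: a_def)
  have M1: "\<bar>real j * m j\<bar> \<le> real j * M j" for j
  proof -
    have "m j \<le> M j" by (rule LIMSEQ_le_const2[OF lim]) (use bound v in \<open>auto simp: field_simps\<close>)
    moreover have "0 \<le> m j" by (rule LIMSEQ_le_const[OF lim]) (use pos v in \<open>auto intro!: divide_nonneg_pos\<close>)
    ultimately show ?thesis by (simp add: mult_left_mono)
  qed
  have sm: "summable (\<lambda>j. real j * m j)"
    by (rule summable_comparison_test'[OF sM, of 0]) (use M1 in auto)
  have "(\<lambda>k. \<Sum>j. a j k) \<longlonglongrightarrow> (\<Sum>j. complex_of_real (- (t\<^sup>2 / (2 * \<sigma>2) * (real j * m j))))"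
    by (rule tannerys_theorem[where M = "\<lambda>j. t\<^sup>2 / (2 * \<sigma>2) * (real j * M j)", OF a_lim _ summable_mult[OF sM], THEN conjunct2, THEN conjunct2])
       (intro always_eventually allI, use a_bound in auto)
  also have "(\<Sum>j. complex_of_real (- (t\<^sup>2 / (2 * \<sigma>2) * (real j * m j)))) = of_real (- (t\<^sup>2 / 2))"
  proof -
    have "(\<lambda>j. complex_of_real (- (t\<^sup>2 / (2 * \<sigma>2) * (real j * m j)))) sums of_real (- (t\<^sup>2 / (2 * \<sigma>2) * \<sigma>2))"
      unfolding \<sigma>2_def by (intro sums_of_real sums_minus sums_mult summable_sums sm)
    then show ?thesis using \<sigma>2 sums_unique[symmetric] by simp
  qed
  finally have "(\<lambda>k. exp (\<Sum>j. a j k)) \<longlonglongrightarrow> exp (of_real (- (t\<^sup>2 / 2)))" by (rule tendsto_exp)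
  then have "(\<lambda>k. \<Sum>i. of_real (compound_poisson (\<phi> k) i) * iexp (t / s k * (real i - suminf (\<phi> k)))) \<longlonglongrightarrow> of_real (exp (- (t\<^sup>2 / 2)))"
    by (simp only: sums_unique[OF sums, symmetric] exp_of_real)
  then show ?thesis by (simp only: s_def \<sigma>2_def)
qed

section \<open>Slow variation and tilting\<close>

lemma ratio_window_finite:
  "finite {f m | m :: int. - w \<le> real_of_int m \<and> real_of_int m \<le> w}"
proof -
  have "finite {m :: int. - w \<le> real_of_int m \<and> real_of_int m \<le> w}"
    by (rule finite_subset[of _ "{\<lceil>- w\<rceil>..\<lfloor>w\<rfloor>}"]) (auto simp: ceiling_le_iff le_floor_iff)
  then show ?thesis by (simp add: setcompr_eq_image)
qed

text \<open>
  The maximum in the hypothesis bounds \<open>h (n + m) / h n\<close> only from above. Applied at \<open>n + m\<close> in place of \<open>n\<close>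
  and \<open>- m\<close> in place of \<open>m\<close> it also bounds the ratio from below. The exponent \<open>b' < 1\<close> keeps \<open>n + m\<close>
  at or above \<open>n / 2\<close>, and the window \<open>(n / 2) powr b'\<close> then lies within the windows of both points.
\<close>
lemma h_ratio_uniform:
  fixes h :: "int \<Rightarrow> real"
  assumes ratio: "(\<lambda>n :: nat. Max {h (int n + m) / h (int n) | m :: int.
          - (real n powr b) \<le> real_of_int m \<and> real_of_int m \<le> real n powr b}) \<longlonglongrightarrow> 1"
    and pos: "\<And>n. 1 \<le> n \<Longrightarrow> 0 < h (int n)" and b: "b' \<le> b" "0 < b'" "b' < 1" and \<epsilon>: "0 < \<epsilon>"
  shows "\<exists>n0 :: nat. \<forall>n\<ge>n0. \<forall>m :: int. \<bar>real_of_int m\<bar> \<le> (real n / 2) powr b' \<longrightarrow> \<bar>h (int n + m) / h (int n) - 1\<bar> \<le> \<epsilon>"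
proof -
  have "eventually (\<lambda>n :: nat. Max {h (int n + m) / h (int n) | m :: int.
          - (real n powr b) \<le> real_of_int m \<and> real_of_int m \<le> real n powr b} < 1 + \<epsilon>) sequentially"
    using ratio \<epsilon> by (intro order_tendstoD(2)[OF ratio]) auto
  then obtain n1 where n1: "\<And>n :: nat. n1 \<le> n \<Longrightarrow> Max {h (int n + m) / h (int n) | m :: int.
          - (real n powr b) \<le> real_of_int m \<and> real_of_int m \<le> real n powr b} < 1 + \<epsilon>"
    by (auto simp: eventually_sequentially)
  have upper: "h (int n + m) / h (int n) \<le> 1 + \<epsilon>"
    if n: "n1 \<le> n" "1 \<le> n" and m: "\<bar>real_of_int m\<bar> \<le> real n powr b'" for n :: nat and m :: int
  proof -
    have "real n powr b' \<le> real n powr b" using n b by (intro powr_mono) auto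
    then have "h (int n + m) / h (int n) \<in> {h (int n + m) / h (int n) | m :: int.
          - (real n powr b) \<le> real_of_int m \<and> real_of_int m \<le> real n powr b}"
      using m by auto
    from Max_ge[OF ratio_window_finite this] n1[OF n(1)] show ?thesis by linarith
  qed
  show ?thesis
  proof (intro exI[of _ "2 * n1 + 4"] allI impI)
    fix n :: nat and m :: int
    assume n: "2 * n1 + 4 \<le> n" and m: "\<bar>real_of_int m\<bar> \<le> (real n / 2) powr b'"
    have "(real n / 2) powr b' \<le> (real n / 2) powr 1" using n b by (intro powr_mono) auto
    then have m2: "\<bar>real_of_int m\<bar> \<le> real n / 2" using m n by simp
    \<comment> \<open>this point is at least \<open>n / 2\<close>, hence at least \<open>n1\<close>\<close>
    define n' where "n' = nat (int n + m)"
    have n': "int n' = int n + m" "real n / 2 \<le> real n'" "n1 \<le> n'" "1 \<le> n'"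
    proof -
      show *: "int n' = int n + m" unfolding n'_def using m2 by (simp add: abs_le_iff)
      then have "real n' = real n + real_of_int m" by (metis of_int_add of_int_of_nat_eq)
      then show **: "real n / 2 \<le> real n'" using m2 by linarith
      show "n1 \<le> n'" "1 \<le> n'" using ** n by linarith+
    qed
    have "(real n / 2) powr b' \<le> real n powr b'" using b by (intro powr_mono2) auto
    then have A: "h (int n + m) / h (int n) \<le> 1 + \<epsilon>" using n m by (intro upper) auto
    have "(real n / 2) powr b' \<le> real n' powr b'" using b n'(2) by (intro powr_mono2) auto
    then have "h (int n' + (- m)) / h (int n') \<le> 1 + \<epsilon>" using n'(3,4) m by (intro upper) auto
    then have B: "h (int n) \<le> (1 + \<epsilon>) * h (int n + m)"
      using pos[OF n'(4)] n'(1) by (simp add: divide_le_eq)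
    have hn: "0 < h (int n)" using pos n by simp
    have "1 \<le> (1 + \<epsilon>) * (h (int n + m) / h (int n))" using B hn by (simp add: field_simps)
    then have "(1 - \<epsilon>) * 1 \<le> (1 - \<epsilon>) * ((1 + \<epsilon>) * (h (int n + m) / h (int n)))" if "\<epsilon> \<le> 1"
      using that by (intro mult_left_mono) auto
    \<comment> \<open>that is, \<open>1 - \<epsilon> \<le> 1 / (1 + \<epsilon>)\<close>\<close>
    moreover have "(1 - \<epsilon>) * ((1 + \<epsilon>) * r) \<le> r" if "0 \<le> r" for r
    proof -
      have "(1 - \<epsilon>) * ((1 + \<epsilon>) * r) = r - \<epsilon>\<^sup>2 * r" by (simp add: algebra_simps power2_eq_square)
      then show ?thesis using that by simp
    qed
    moreover have "0 \<le> h (int n + m) / h (int n)" using hn pos[OF n'(4)] n'(1) by simp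
    ultimately have "1 - \<epsilon> \<le> h (int n + m) / h (int n)"
      by (cases "\<epsilon> \<le> 1") (fastforce intro: order.trans)+
    with A show "\<bar>h (int n + m) / h (int n) - 1\<bar> \<le> \<epsilon>" by linarith
  qed
qed

text \<open>
  If the density \<open>g\<close> is close to 1 in mean, then averages of bounded functions under the tilted and
  normalized law have the same limits as under the original law.
\<close>
lemma tilted_average_tendsto:
  fixes p g :: "nat \<Rightarrow> nat \<Rightarrow> real" and f :: "nat \<Rightarrow> nat \<Rightarrow> complex"
  assumes p: "\<And>k i. 0 \<le> p k i" "\<And>k. p k sums 1"
    and sg: "\<forall>\<^sub>F k in sequentially. summable (\<lambda>i. \<bar>g k i - 1\<bar> * p k i)"
    and g1: "(\<lambda>k. \<Sum>i. \<bar>g k i - 1\<bar> * p k i) \<longlonglongrightarrow> 0"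
    and f: "\<And>k i. norm (f k i) \<le> 1" and lim: "(\<lambda>k. \<Sum>i. of_real (p k i) * f k i) \<longlonglongrightarrow> l"
  shows "(\<lambda>k. (\<Sum>i. of_real (g k i * p k i) * f k i) / of_real (\<Sum>i. g k i * p k i)) \<longlonglongrightarrow> l"
proof -
  have main: "(\<lambda>k. \<Sum>i. of_real (g k i * p k i) * f k i) \<longlonglongrightarrow> l"
    if f: "\<And>k i. norm (f k i) \<le> 1" and lim: "(\<lambda>k. \<Sum>i. of_real (p k i) * f k i) \<longlonglongrightarrow> l" for f :: "nat \<Rightarrow> nat \<Rightarrow> complex" and l
  proof -
    have "(\<lambda>k. (\<Sum>i. of_real (g k i * p k i) * f k i) - (\<Sum>i. of_real (p k i) * f k i)) \<longlonglongrightarrow> 0"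
    proof (rule Lim_null_comparison[OF _ g1])
      show "\<forall>\<^sub>F k in sequentially. norm ((\<Sum>i. of_real (g k i * p k i) * f k i) - (\<Sum>i. of_real (p k i) * f k i)) \<le> (\<Sum>i. \<bar>g k i - 1\<bar> * p k i)"
        using sg
      proof eventually_elim
        case (elim k)
        have n1: "norm (complex_of_real (p k i) * f k i) \<le> p k i" for i
          using mult_left_mono[OF f[of k i] p(1)[of k i]] p(1)[of k i] by (simp add: norm_mult)
        have n2: "norm (complex_of_real ((g k i - 1) * p k i) * f k i) \<le> \<bar>g k i - 1\<bar> * p k i" for i
          using mult_left_mono[OF f[of k i], of "\<bar>g k i - 1\<bar> * p k i"] p(1)[of k i] by (simp add: norm_mult abs_mult del: of_real_mult of_real_diff)
        have s1: "summable (\<lambda>i. of_real (p k i) * f k i)"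
          by (rule summable_comparison_test'[OF sums_summable[OF p(2)[of k]], of 0]) (rule n1)
        have s2: "summable (\<lambda>i. norm (complex_of_real ((g k i - 1) * p k i) * f k i))"
          by (rule summable_comparison_test'[OF elim, of 0]) (use n2 in simp)
        have eq: "complex_of_real (g k i * p k i) * f k i = of_real ((g k i - 1) * p k i) * f k i + of_real (p k i) * f k i" for i
          by (simp add: algebra_simps)
        have "(\<Sum>i. of_real (g k i * p k i) * f k i) - (\<Sum>i. of_real (p k i) * f k i) = (\<Sum>i. of_real ((g k i - 1) * p k i) * f k i)"
          unfolding eq by (subst suminf_add[OF summable_norm_cancel[OF s2] s1, symmetric]) simp
        also have "norm \<dots> \<le> (\<Sum>i. norm (complex_of_real ((g k i - 1) * p k i) * f k i))"
          by (rule summable_norm[OF s2])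
        also have "\<dots> \<le> (\<Sum>i. \<bar>g k i - 1\<bar> * p k i)"
          by (rule suminf_le[OF n2 s2 elim])
        finally show ?case .
      qed
    qed
    from tendsto_add[OF this lim] show ?thesis by simp
  qed
  have one: "(\<lambda>k. \<Sum>i. of_real (g k i * p k i) * (1 :: complex)) \<longlonglongrightarrow> 1"
  proof (rule main)
    have "(\<Sum>i. complex_of_real (p k i)) = 1" for k
      using sums_unique[OF sums_of_real[OF p(2)[of k]]] by simp
    then show "(\<lambda>k. \<Sum>i. of_real (p k i) * (1 :: complex)) \<longlonglongrightarrow> 1" by simp
  qed simp
  have "\<forall>\<^sub>F k in sequentially. (\<Sum>i. of_real (g k i * p k i) * (1 :: complex)) = of_real (\<Sum>i. g k i * p k i)"
    using sg
  proof eventually_elim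
    case (elim k)
    have "summable (\<lambda>i. (g k i - 1) * p k i)"
      by (rule summable_comparison_test'[OF elim, of 0]) (use p(1)[of k] in \<open>simp add: abs_mult\<close>)
    from summable_add[OF this sums_summable[OF p(2)[of k]]] have "summable (\<lambda>i. g k i * p k i)"
      by (simp add: algebra_simps)
    then have "complex_of_real (\<Sum>i. g k i * p k i) = (\<Sum>i. of_real (g k i * p k i))" by (rule suminf_of_real)
    then show ?case by simp
  qed
  with one have "(\<lambda>k. complex_of_real (\<Sum>i. g k i * p k i)) \<longlonglongrightarrow> 1"
    by (rule Lim_transform_eventually)
  from tendsto_divide[OF main[OF f lim] this] show ?thesis by simp
qed

text \<open>
  Split according to whether \<open>i\<close> lies within distance \<open>D\<close> of the centre \<open>\<mu>\<close>.
\<close>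
lemma tilted_deviation_bound:
  fixes p g :: "nat \<Rightarrow> real"
  assumes p: "\<And>i. 0 \<le> p i" "p sums 1" and E: "0 \<le> E" and \<epsilon>: "0 \<le> \<epsilon>"
    and near: "\<And>i. \<bar>real i - \<mu>\<bar> \<le> D \<Longrightarrow> \<bar>g i - 1\<bar> \<le> \<epsilon>"
    and far: "\<And>i. \<bar>g i - 1\<bar> \<le> E"
    and tail: "summable (\<lambda>i. p i * of_bool (D < \<bar>real i - \<mu>\<bar>))"
  shows "summable (\<lambda>i. \<bar>g i - 1\<bar> * p i)"
    and "(\<Sum>i. \<bar>g i - 1\<bar> * p i) \<le> \<epsilon> + E * (\<Sum>i. p i * of_bool (D < \<bar>real i - \<mu>\<bar>))"
proof -
  have le: "\<bar>g i - 1\<bar> * p i \<le> \<epsilon> * p i + E * (p i * of_bool (D < \<bar>real i - \<mu>\<bar>))" for i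
  proof (cases "D < \<bar>real i - \<mu>\<bar>")
    case True
    have "\<bar>g i - 1\<bar> * p i \<le> E * p i" "0 \<le> \<epsilon> * p i" using far p(1) \<epsilon> by (auto intro: mult_right_mono)
    then show ?thesis using True by simp
  next
    case False
    then show ?thesis using near[of i] p(1)[of i] by (simp add: mult_right_mono)
  qed
  have sm: "summable (\<lambda>i. \<epsilon> * p i + E * (p i * of_bool (D < \<bar>real i - \<mu>\<bar>)))"
    by (intro summable_add summable_mult tail sums_summable[OF p(2)])
  show s: "summable (\<lambda>i. \<bar>g i - 1\<bar> * p i)"
    by (rule summable_comparison_test'[OF sm, of 0]) (use le p(1) in \<open>simp add: abs_mult\<close>)
  have "(\<Sum>i. \<bar>g i - 1\<bar> * p i) \<le> (\<Sum>i. \<epsilon> * p i + E * (p i * of_bool (D < \<bar>real i - \<mu>\<bar>)))"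
    by (rule suminf_le[OF le s sm])
  also have "\<dots> = \<epsilon> * suminf p + E * (\<Sum>i. p i * of_bool (D < \<bar>real i - \<mu>\<bar>))"
    by (simp only: suminf_add[OF summable_mult[OF sums_summable[OF p(2)]] summable_mult[OF tail], symmetric]
       suminf_mult[OF sums_summable[OF p(2)]] suminf_mult[OF tail])
  finally show "(\<Sum>i. \<bar>g i - 1\<bar> * p i) \<le> \<epsilon> + E * (\<Sum>i. p i * of_bool (D < \<bar>real i - \<mu>\<bar>))"
    using sums_unique[OF p(2)] by simp
qed

text \<open>
  The form in which the relation between \<open>a\<close> and \<open>b\<close> enters, with \<open>x\<close> the linear size of the system. Up to
  constants in the exponents, the tilt grows like \<open>exp (x powr e2)\<close>, and the Chernoff bound
  decays like \<open>exp (- (x powr (e1 - e3)))\<close>.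
\<close>
lemma tail_beats_tilt:
  fixes S c \<kappa> e1 e2 e3 :: real
  assumes "0 < \<kappa>" "0 \<le> e2" "0 < c" "e3 + e2 < e1" "0 \<le> e3"
  shows "((\<lambda>x :: real. (1 + A * exp (c * x powr e2)) * (2 * exp (S - (1/2) * x powr (- e3) * (\<kappa> * x powr e1 - 1)))) \<longlongrightarrow> 0) at_top"
proof -
  let ?Y = "\<lambda>x :: real. (1/2) * x powr (- e3) * (\<kappa> * x powr e1 - 1)"
  define q where "q = e1 - e3"
  have q: "e2 < q" "0 < q" using assms by (auto simp: q_def)
  have "filterlim (\<lambda>x :: real. c * x powr e2 - \<kappa> / 2 * x powr q) at_bot at_top"
  proof (cases "e2 = 0")
    case True
    have "filterlim (\<lambda>x :: real. c - \<kappa> / 2 * x powr q) at_bot at_top"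
      using assms q by real_asymp
    moreover have "\<forall>\<^sub>F x :: real in at_top. c - \<kappa> / 2 * x powr q = c * x powr e2 - \<kappa> / 2 * x powr q"
      using eventually_gt_at_top[of 0] by eventually_elim (simp add: True)
    ultimately show ?thesis by (rule filterlim_cong[OF refl refl, THEN iffD1, rotated])
  next
    case False
    then have "0 < e2" using assms by simp
    then show ?thesis using assms q by real_asymp
  qed
  then have "((\<lambda>x :: real. exp (c * x powr e2 - \<kappa> / 2 * x powr q)) \<longlongrightarrow> 0) at_top"
    by (rule filterlim_compose[OF exp_at_bot])
  then have lim: "((\<lambda>x :: real. (1 + \<bar>A\<bar>) * (2 * exp (S + 1/2)) * exp (c * x powr e2 - \<kappa> / 2 * x powr q)) \<longlongrightarrow> 0) at_top"
    by (rule tendsto_mult_right_zero)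
  show ?thesis
  proof (rule Lim_null_comparison[OF _ lim])
    show "\<forall>\<^sub>F x :: real in at_top. norm ((1 + A * exp (c * x powr e2)) * (2 * exp (S - ?Y x)))
       \<le> (1 + \<bar>A\<bar>) * (2 * exp (S + 1/2)) * exp (c * x powr e2 - \<kappa> / 2 * x powr q)"
      using eventually_ge_at_top[of 1]
    proof eventually_elim
      case (elim x)
      have "x powr (- e3) \<le> x powr 0" using elim assms by (intro powr_mono) auto
      moreover have "x powr (- e3) * x powr e1 = x powr q" by (simp add: powr_add[symmetric] q_def)
      ultimately have Y: "\<kappa> / 2 * x powr q - 1/2 \<le> ?Y x" using elim by (simp add: algebra_simps)
      have "norm (1 + A * exp (c * x powr e2)) \<le> 1 + \<bar>A\<bar> * exp (c * x powr e2)"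
        by (rule order.trans[OF norm_triangle_ineq]) (simp add: abs_mult)
      also have "\<dots> \<le> (1 + \<bar>A\<bar>) * exp (c * x powr e2)" using assms by (simp add: algebra_simps)
      finally have 1: "norm (1 + A * exp (c * x powr e2)) \<le> (1 + \<bar>A\<bar>) * exp (c * x powr e2)" .
      have 2: "norm (2 * exp (S - ?Y x)) \<le> 2 * exp (S + 1/2 - \<kappa> / 2 * x powr q)"
        using Y by simp
      have "norm ((1 + A * exp (c * x powr e2)) * (2 * exp (S - ?Y x)))
         \<le> ((1 + \<bar>A\<bar>) * exp (c * x powr e2)) * (2 * exp (S + 1/2 - \<kappa> / 2 * x powr q))"
        unfolding norm_mult[of "1 + A * exp (c * x powr e2)"] by (intro mult_mono 1 2) auto
      also have "\<dots> = (1 + \<bar>A\<bar>) * (2 * exp (S + 1/2)) * exp (c * x powr e2 - \<kappa> / 2 * x powr q)"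
        by (simp add: exp_add exp_diff)
      finally show ?case .
    qed
  qed
qed

lemma compound_poisson_sums:
  assumes pos: "\<And>j. 0 \<le> \<phi> j" and zero: "\<phi> 0 = 0" and s: "summable \<phi>"
  shows "compound_poisson \<phi> sums 1"
proof -
  have "summable (\<lambda>j. \<phi> j / real j)"
  proof (rule summable_comparison_test'[OF s, of 1])
    fix j :: nat assume "1 \<le> j"
    then show "norm (\<phi> j / real j) \<le> \<phi> j"
      using pos[of j] by (simp add: divide_le_eq mult_le_cancel_left1)
  qed
  then have "(\<lambda>k. complex_of_real (compound_poisson \<phi> k) * exp (0 * of_real (real k - suminf \<phi>))) sums
     exp (\<Sum>j. of_real (\<phi> j / real j) * (exp (0 * of_nat j) - 1 - 0 * of_nat j))"
    by (intro compound_poisson_transform[OF pos zero _ s]) simp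
  then have "(\<lambda>k. complex_of_real (compound_poisson \<phi> k)) sums of_real 1" by simp
  then show ?thesis by (simp only: sums_of_real_iff)
qed

text \<open>
  The density is normalized by the value of \<open>h\<close> at the integer \<open>N k - \<lfloor>\<mu>\<rfloor>\<close>, which is eventually at least a
  fixed fraction of \<open>N k\<close> because \<open>r < \<rho>\<close>. Near the mean \<open>h_ratio_uniform\<close> applies; far from it the
  growth bounds on \<open>h\<close> are outweighed by \<open>compound_poisson_chernoff\<close> with
  \<open>\<tau> = L powr (- max \<delta> (d / 2)) / 2\<close>: this rate is admissible, since \<open>\<tau> \<le> L powr (- \<delta>) / 2\<close>, and it
  keeps the quadratic term \<open>\<tau>\<^sup>2 * L ^ d\<close> bounded.
\<close>
lemma tilt_negligible:
  fixes L :: "nat \<Rightarrow> real" and N :: "nat \<Rightarrow> nat" and h :: "int \<Rightarrow> real" and \<phi> :: "nat \<Rightarrow> nat \<Rightarrow> real" and d :: nat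
  assumes d: "0 < d" and \<delta>: "0 < \<delta>" and r: "r < \<rho>" "0 < \<rho>"
    and C: "0 < C" and c: "0 < c"
    and a: "0 \<le> a" "a + max (1/2) (\<delta> / real d) < 1"
    and b: "a + max (1/2) (\<delta> / real d) < b"
    and h_neg: "\<And>m. m < 0 \<Longrightarrow> h m = 0" and h_0: "h 0 = 1"
    and h_bounds: "\<And>n :: nat. 1 \<le> n \<Longrightarrow> inverse C * exp (- c * real n powr a) \<le> h (int n) \<and> h (int n) \<le> C * exp (c * real n powr a)"
    and h_ratio: "(\<lambda>n :: nat. Max {h (int n + m) / h (int n) | m :: int.
          - (real n powr b) \<le> real_of_int m \<and> real_of_int m \<le> real n powr b}) \<longlonglongrightarrow> 1"
    and L_pos: "\<And>k. 0 < L k" and L_lim: "filterlim L at_top sequentially"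
    and N_L: "\<And>k. real (N k) = \<rho> * L k ^ d"
    and pos: "\<And>k j. 0 \<le> \<phi> k j" and zero: "\<And>k. \<phi> k 0 = 0"
    and bound: "\<And>k j. \<phi> k j * exp (real j * (L k powr (- \<delta>) / 2)) \<le> L k ^ d * M j"
    and sM: "summable (\<lambda>j. real j * M j)"
    and mean: "(\<lambda>k. suminf (\<phi> k) / L k ^ d) \<longlonglongrightarrow> r"
  defines "g \<equiv> \<lambda>k i. h (int (N k) - int i) / h (int (N k) - \<lfloor>suminf (\<phi> k)\<rfloor>)"
  shows "\<forall>\<^sub>F k in sequentially. summable (\<lambda>i. \<bar>g k i - 1\<bar> * compound_poisson (\<phi> k) i)"
    and "(\<lambda>k. \<Sum>i. \<bar>g k i - 1\<bar> * compound_poisson (\<phi> k) i) \<longlonglongrightarrow> 0"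
    and "\<forall>\<^sub>F k in sequentially. 0 < h (int (N k) - \<lfloor>suminf (\<phi> k)\<rfloor>)"
proof -
  define \<mu> where "\<mu> = (\<lambda>k. suminf (\<phi> k))"
  define p where "p = (\<lambda>k. compound_poisson (\<phi> k))"
  \<comment> \<open>a window exponent that is still above the threshold, but below 1\<close>
  define b' where "b' = (a + max (1/2) (\<delta> / real d) + min 1 b) / 2"
  have b': "a + max (1/2) (\<delta> / real d) < b'" "b' \<le> b" "0 < b'" "b' < 1"
  proof -
    have "1/2 \<le> a + max (1/2) (\<delta> / real d)"
      using a(1) max.cobounded1[of "1/2" "\<delta> / real d"] by linarith
    then show "a + max (1/2) (\<delta> / real d) < b'" "b' \<le> b" "0 < b'" "b' < 1"
      using a(2) b unfolding b'_def by (cases "1 \<le> b"; simp)+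
  qed
  \<comment> \<open>half of the condensate fraction in the limit\<close>
  define \<kappa> where "\<kappa> = (\<rho> - r) / (2 * \<rho>)"
  have \<kappa>: "0 < \<kappa>" using r by (simp add: \<kappa>_def)
  \<comment> \<open>the subtracted 1 makes room for rounding \<open>\<mu>\<close> to an integer\<close>
  define D where "D = (\<lambda>k. (\<kappa> * real (N k) / 2) powr b' - 1)"
  define A where "A = C * max C 1"
  \<comment> \<open>what the growth bounds on \<open>h\<close> give for \<open>\<bar>g k i - 1\<bar>\<close> at an arbitrary \<open>i\<close>\<close>
  define E where "E = (\<lambda>k. 1 + A * exp (2 * c * real (N k) powr a))"
  define S where "S = (\<Sum>j. real j * M j)"
  define e3 where "e3 = max \<delta> (real d / 2)"
  define tail where "tail = (\<lambda>k. \<Sum>i. p k i * of_bool (D k < \<bar>real i - \<mu> k\<bar>))"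
  have M0: "0 \<le> M j" for j
    using order.trans[OF mult_nonneg_nonneg[OF pos exp_ge_zero] bound, of 0 j] zero_less_power[OF L_pos[of 0], of d]
    by (auto simp: zero_le_mult_iff)
  have S0: "0 \<le> S" unfolding S_def using M0 by (intro suminf_nonneg sM) auto
  have A0: "0 \<le> A" using C by (simp add: A_def)
  have E0: "0 \<le> E k" for k using A0 by (simp add: E_def)
  have sum\<phi>: "summable (\<phi> k)" for k
    by (rule compound_poisson_exp_moment(3)[where \<phi> = "\<phi> k" and t = 0, OF pos zero _ bound sM]) simp
  have \<mu>0: "0 \<le> \<mu> k" for k unfolding \<mu>_def by (intro suminf_nonneg sum\<phi> pos)
  have p: "0 \<le> p k i" "p k sums 1" for k i
    unfolding p_def using compound_poisson_nonneg[of "\<phi> k"] compound_poisson_sums[of "\<phi> k"] pos zero sum\<phi> by auto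
  have h_nn: "0 \<le> h m" and h_le: "m \<le> int n \<Longrightarrow> h m \<le> max C 1 * exp (c * real n powr a)" for m n
  proof -
    consider "m < 0" | "m = 0" | l :: nat where "m = int l" "1 \<le> l"
      by (metis One_nat_def Suc_leI gr_zeroI int_cases2 linorder_neqE_linordered_idom of_nat_0 zero_less_imp_eq_int)
    then have "0 \<le> h m \<and> (m \<le> int n \<longrightarrow> h m \<le> max C 1 * exp (c * real n powr a))"
    proof cases
      case 1
      then show ?thesis using C by (simp add: h_neg)
    next
      case 2
      have "1 * 1 \<le> max C 1 * exp (c * real n powr a)" using c by (intro mult_mono) auto
      then show ?thesis using 2 by (simp add: h_0)
    next
      case (3 l)
      have "0 \<le> inverse C * exp (- c * real l powr a)" using C by simp
      then have "0 \<le> h m" unfolding 3(1) using h_bounds[OF 3(2)] by linarith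
      moreover have "h m \<le> max C 1 * exp (c * real n powr a)" if "m \<le> int n"
      proof -
        have "real l powr a \<le> real n powr a" using that 3 a by (intro powr_mono2) auto
        then have "C * exp (c * real l powr a) \<le> max C 1 * exp (c * real n powr a)"
          using c C by (intro mult_mono) auto
        then show ?thesis unfolding 3(1) using h_bounds[OF 3(2)] by linarith
      qed
      ultimately show ?thesis by blast
    qed
    then show "0 \<le> h m" "m \<le> int n \<Longrightarrow> h m \<le> max C 1 * exp (c * real n powr a)" by auto
  qed
  have h_pos: "0 < h (int n)" if "1 \<le> n" for n
    using h_bounds[OF that] C by (smt (verit) exp_gt_zero inverse_positive_iff_positive mult_pos_pos)
  have N_lim: "filterlim (\<lambda>k. real (N k)) at_top sequentially"
    unfolding N_L using d r(2) by (intro filterlim_tendsto_pos_mult_at_top[OF tendsto_const] filterlim_pow_at_top L_lim) auto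
  have mean': "(\<lambda>k. \<mu> k / L k ^ d) \<longlonglongrightarrow> r" using mean by (simp add: \<mu>_def)
  have good: "eventually (\<lambda>k. 1 \<le> L k \<and> X \<le> \<kappa> * real (N k) \<and> \<kappa> * real (N k) \<le> real (N k) - \<mu> k) sequentially" for X
  proof -
    have "eventually (\<lambda>k. \<mu> k / L k ^ d < (\<rho> + r) / 2) sequentially"
      using r by (intro order_tendstoD(2)[OF mean']) auto
    moreover have "eventually (\<lambda>k. 1 \<le> L k) sequentially"
      using L_lim by (simp add: filterlim_at_top)
    moreover have "eventually (\<lambda>k. X / \<kappa> \<le> real (N k)) sequentially"
      using N_lim by (simp add: filterlim_at_top)
    ultimately show ?thesis
    proof eventually_elim
      case (elim k)
      have "\<mu> k \<le> (\<rho> + r) / 2 * L k ^ d" using elim(1) L_pos[of k] by (simp add: field_simps)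
      moreover have "\<kappa> * real (N k) = (\<rho> - r) / 2 * L k ^ d" unfolding N_L \<kappa>_def using r by simp
      ultimately have "\<kappa> * real (N k) \<le> real (N k) - \<mu> k" unfolding N_L by (simp add: field_simps)
      moreover have "X \<le> \<kappa> * real (N k)" using elim(3) \<kappa> by (simp add: field_simps)
      ultimately show ?case using elim(2) by simp
    qed
  qed
  have base: "\<exists>n0 :: nat. int n0 = int (N k) - \<lfloor>\<mu> k\<rfloor> \<and> \<kappa> * real (N k) \<le> real n0 \<and> n0 \<le> N k"
    if "\<kappa> * real (N k) \<le> real (N k) - \<mu> k" for k
  proof -
    have "0 \<le> \<kappa> * real (N k)" using \<kappa> by simp
    then have "\<mu> k \<le> real (N k)" using that by linarith
    then have f: "0 \<le> \<lfloor>\<mu> k\<rfloor>" "\<lfloor>\<mu> k\<rfloor> \<le> int (N k)" using \<mu>0[of k] by (auto simp: floor_le_iff)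
    define n0 where "n0 = nat (int (N k) - \<lfloor>\<mu> k\<rfloor>)"
    have 1: "int n0 = int (N k) - \<lfloor>\<mu> k\<rfloor>" using f by (simp add: n0_def)
    then have "real n0 = real (N k) - real_of_int \<lfloor>\<mu> k\<rfloor>" by (metis of_int_diff of_int_of_nat_eq)
    moreover have "real_of_int \<lfloor>\<mu> k\<rfloor> \<le> \<mu> k" by simp
    ultimately have "\<kappa> * real (N k) \<le> real n0" using that by linarith
    moreover have "n0 \<le> N k" using 1 f by linarith
    ultimately show ?thesis using 1 by blast
  qed
  have tail: "summable (\<lambda>i. p k i * of_bool (D k < \<bar>real i - \<mu> k\<bar>))"
     "tail k \<le> 2 * exp (S / 2 - 1/2 * L k powr (- e3) * D k)" if L1: "1 \<le> L k" for k
  proof -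
    define \<tau> where "\<tau> = 1/2 * L k powr (- e3)"
    have "L k powr (- e3) \<le> L k powr (- \<delta>)" using L1 by (intro powr_mono) (auto simp: e3_def)
    then have "\<tau> \<le> L k powr (- \<delta>) / 2" by (simp add: \<tau>_def)
    then have "real j * \<tau> \<le> real j * (L k powr (- \<delta>) / 2)" for j by (intro mult_left_mono) auto
    then have "\<phi> k j * exp (real j * \<tau>) \<le> \<phi> k j * exp (real j * (L k powr (- \<delta>) / 2))" for j
      using pos[of k j] by (intro mult_left_mono) (simp_all only: exp_le_cancel_iff)
    then have b\<tau>: "\<phi> k j * exp (real j * \<tau>) \<le> L k ^ d * M j" for j
      using bound[of k j] by (rule order.trans)
    have \<tau>0: "0 \<le> \<tau>" by (simp add: \<tau>_def)
    note ch = compound_poisson_chernoff[where \<phi> = "\<phi> k", OF pos zero \<tau>0 b\<tau> sM]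
    show "summable (\<lambda>i. p k i * of_bool (D k < \<bar>real i - \<mu> k\<bar>))"
      unfolding p_def \<mu>_def by (rule ch(1))
    have "L k powr (- e3) * L k powr (- e3) * L k ^ d = L k powr (real d - 2 * e3)"
      using L_pos[of k] by (simp add: powr_realpow[symmetric] powr_add[symmetric])
    also have "\<dots> \<le> L k powr 0" using L1 by (intro powr_mono) (auto simp: e3_def)
    finally have "\<tau>\<^sup>2 * L k ^ d \<le> 1" using L_pos[of k] by (simp add: \<tau>_def power2_eq_square)
    from mult_right_mono[OF this S0] have "\<tau>\<^sup>2 * L k ^ d * S / 2 \<le> S / 2" by simp
    then have "2 * exp (\<tau>\<^sup>2 * L k ^ d * S / 2 - \<tau> * D k) \<le> 2 * exp (S / 2 - \<tau> * D k)" by simp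
    with ch(2)[of "D k"] show "tail k \<le> 2 * exp (S / 2 - 1/2 * L k powr (- e3) * D k)"
      unfolding tail_def p_def \<mu>_def S_def[symmetric] \<tau>_def by (rule order.trans)
  qed
  have far: "\<bar>g k i - 1\<bar> \<le> E k" if k: "1 \<le> \<kappa> * real (N k)" "\<kappa> * real (N k) \<le> real (N k) - \<mu> k" for k i
  proof -
    obtain n0 :: nat where n0: "int n0 = int (N k) - \<lfloor>\<mu> k\<rfloor>" "\<kappa> * real (N k) \<le> real n0" "n0 \<le> N k"
      using base[OF k(2)] by blast
    have n01: "1 \<le> n0" using n0(2) k(1) by linarith
    have "real n0 powr a \<le> real (N k) powr a" using n0(3) a by (intro powr_mono2) auto
    then have "inverse C * exp (- c * real (N k) powr a) \<le> inverse C * exp (- c * real n0 powr a)"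
      using C c by (intro mult_left_mono) auto
    then have low: "inverse C * exp (- c * real (N k) powr a) \<le> h (int n0)" using h_bounds[OF n01] by linarith
    have "h (int (N k) - int i) / h (int n0) \<le> (max C 1 * exp (c * real (N k) powr a)) / (inverse C * exp (- c * real (N k) powr a))"
      using h_nn C by (intro frac_le low h_le) auto
    also have "\<dots> = A * exp (2 * c * real (N k) powr a)"
      using C by (simp add: A_def exp_minus field_simps exp_add[symmetric])
    finally have "g k i \<le> A * exp (2 * c * real (N k) powr a)" by (simp add: g_def n0(1) \<mu>_def)
    moreover have "0 \<le> g k i" by (simp add: g_def h_nn)
    moreover have "0 \<le> A * exp (2 * c * real (N k) powr a)" using A0 by simp
    ultimately show ?thesis unfolding E_def by linarith
  qed
  have tail_lim: "(\<lambda>k. E k * (2 * exp (S / 2 - 1/2 * L k powr (- e3) * D k))) \<longlonglongrightarrow> 0"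
  proof -
    have "((\<lambda>x :: real. (1 + A * exp ((2 * c * \<rho> powr a) * x powr (real d * a))) * (2 * exp (S / 2 - (1/2) * x powr (- e3) * ((\<kappa> * \<rho> / 2) powr b' * x powr (real d * b') - 1)))) \<longlongrightarrow> 0) at_top"
    proof (rule tail_beats_tilt)
      have "real d * (a + max (1/2) (\<delta> / real d)) < real d * b'" using b'(1) d by simp
      also have "real d * (a + max (1/2) (\<delta> / real d)) = real d * a + e3"
        using d by (auto simp: e3_def max_def field_simps)
      finally show "e3 + real d * a < real d * b'" by linarith
    qed (use \<kappa> r c a \<delta> in \<open>auto simp: e3_def\<close>)
    from filterlim_compose[OF this L_lim]
    have "(\<lambda>k. (1 + A * exp ((2 * c * \<rho> powr a) * L k powr (real d * a))) * (2 * exp (S / 2 - (1/2) * L k powr (- e3) * ((\<kappa> * \<rho> / 2) powr b' * L k powr (real d * b') - 1)))) \<longlonglongrightarrow> 0" .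
    moreover have "real (N k) powr a = \<rho> powr a * L k powr (real d * a)" for k
      unfolding N_L using r L_pos[of k] by (simp add: powr_mult powr_realpow[symmetric] powr_powr)
    moreover have "(\<kappa> * real (N k) / 2) powr b' = (\<kappa> * \<rho> / 2) powr b' * L k powr (real d * b')" for k
    proof -
      have "\<kappa> * real (N k) / 2 = (\<kappa> * \<rho> / 2) * L k powr real d" unfolding N_L using L_pos[of k] by (simp add: powr_realpow)
      then show ?thesis using r \<kappa> by (simp only:) (subst powr_mult, auto simp: powr_powr)
    qed
    ultimately show ?thesis by (simp add: E_def D_def mult.assoc)
  qed
  have dev: "summable (\<lambda>i. \<bar>g k i - 1\<bar> * p k i)"
      "(\<And>i. \<bar>real i - \<mu> k\<bar> \<le> D k \<Longrightarrow> \<bar>g k i - 1\<bar> \<le> \<epsilon>) \<Longrightarrow> 0 \<le> \<epsilon> \<Longrightarrow> (\<Sum>i. \<bar>g k i - 1\<bar> * p k i) \<le> \<epsilon> + E k * tail k"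
    if k: "1 \<le> L k" "1 \<le> \<kappa> * real (N k)" "\<kappa> * real (N k) \<le> real (N k) - \<mu> k" for k \<epsilon>
    unfolding tail_def
    using tilted_deviation_bound[where g = "g k", OF p(1) p(2) E0[of k] E0[of k] far[OF k(2,3)] far[OF k(2,3)] tail(1)[OF k(1)]]
      tilted_deviation_bound(2)[where g = "g k", OF p(1) p(2) E0[of k] _ _ far[OF k(2,3)] tail(1)[OF k(1)], of \<epsilon>] by blast+
  show "\<forall>\<^sub>F k in sequentially. summable (\<lambda>i. \<bar>g k i - 1\<bar> * compound_poisson (\<phi> k) i)"
    using good[of 1] by eventually_elim (use dev(1) in \<open>auto simp: p_def\<close>)
  show "\<forall>\<^sub>F k in sequentially. 0 < h (int (N k) - \<lfloor>suminf (\<phi> k)\<rfloor>)"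
    using good[of 1]
  proof eventually_elim
    case (elim k)
    then obtain n0 :: nat where n0: "int n0 = int (N k) - \<lfloor>\<mu> k\<rfloor>" "\<kappa> * real (N k) \<le> real n0"
      using base by blast
    then have "1 \<le> n0" using elim by linarith
    from h_pos[OF this] show ?case by (simp add: n0(1) \<mu>_def)
  qed
  have "(\<lambda>k. \<Sum>i. \<bar>g k i - 1\<bar> * p k i) \<longlonglongrightarrow> 0"
  proof (rule LIMSEQ_I)
    fix \<epsilon> :: real assume \<epsilon>: "0 < \<epsilon>"
    obtain n1 :: nat where n1: "\<And>n m. n1 \<le> n \<Longrightarrow> \<bar>real_of_int m\<bar> \<le> (real n / 2) powr b' \<Longrightarrow> \<bar>h (int n + m) / h (int n) - 1\<bar> \<le> \<epsilon> / 2"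
      using h_ratio_uniform[OF h_ratio h_pos b'(2,3,4), of "\<epsilon> / 2"] \<epsilon> by auto
    have "\<forall>\<^sub>F k in sequentially. E k * (2 * exp (S / 2 - 1/2 * L k powr (- e3) * D k)) < \<epsilon> / 2"
      using \<epsilon> by (intro order_tendstoD(2)[OF tail_lim]) auto
    with good[of "real (n1 + 1)"]
    have "\<forall>\<^sub>F k in sequentially. norm ((\<Sum>i. \<bar>g k i - 1\<bar> * p k i) - 0) < \<epsilon>"
    proof eventually_elim
      case (elim k)
      then have k: "1 \<le> L k" "1 \<le> \<kappa> * real (N k)" "\<kappa> * real (N k) \<le> real (N k) - \<mu> k" by auto
      obtain n0 :: nat where n0: "int n0 = int (N k) - \<lfloor>\<mu> k\<rfloor>" "\<kappa> * real (N k) \<le> real n0"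
        using base[OF k(3)] by blast
      have "n1 \<le> n0" using n0(2) elim by linarith
      have near: "\<bar>g k i - 1\<bar> \<le> \<epsilon> / 2" if i: "\<bar>real i - \<mu> k\<bar> \<le> D k" for i
      proof -
        define m where "m = \<lfloor>\<mu> k\<rfloor> - int i"
        have "\<bar>real_of_int m\<bar> \<le> D k + 1" using i unfolding m_def by simp linarith
        also have "\<dots> \<le> (real n0 / 2) powr b'"
          unfolding D_def using n0(2) k(2) b'(3) by (simp, intro powr_mono2) auto
        finally have "\<bar>h (int n0 + m) / h (int n0) - 1\<bar> \<le> \<epsilon> / 2" by (rule n1[OF \<open>n1 \<le> n0\<close>])
        then show ?thesis by (simp add: g_def n0(1) m_def \<mu>_def)
      qed
      have "(\<Sum>i. \<bar>g k i - 1\<bar> * p k i) \<le> \<epsilon> / 2 + E k * tail k"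
        by (rule dev(2)[OF k near]) (use \<epsilon> in auto)
      also have "E k * tail k \<le> E k * (2 * exp (S / 2 - 1/2 * L k powr (- e3) * D k))"
        by (rule mult_left_mono[OF tail(2)[OF k(1)] E0])
      finally have "(\<Sum>i. \<bar>g k i - 1\<bar> * p k i) < \<epsilon>" using elim by linarith
      moreover have "0 \<le> (\<Sum>i. \<bar>g k i - 1\<bar> * p k i)"
        by (rule suminf_nonneg[OF dev(1)[OF k]]) (use p in auto)
      ultimately show ?case by simp
    qed
    then show "\<exists>n0. \<forall>k\<ge>n0. norm ((\<Sum>i. \<bar>g k i - 1\<bar> * p k i) - 0) < \<epsilon>"
      by (simp add: eventually_sequentially)
  qed
  then show "(\<lambda>k. \<Sum>i. \<bar>g k i - 1\<bar> * compound_poisson (\<phi> k) i) \<longlonglongrightarrow> 0"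
    by (simp add: p_def)
qed

section \<open>The central limit theorem for the origin\<close>

text \<open>
  With \<open>c = L * s powr (- 1 / \<delta>)\<close> one has \<open>s * norm (x / L) powr \<delta> = norm (x / c) powr \<delta>\<close>.
\<close>
lemma lattice_exp_has_sum:
  assumes \<delta>: "0 < \<delta>" and L: "0 < L" and s: "0 < s"
  shows "((\<lambda>x :: int ^ 'd. exp (- s * norm (lattice_point x /\<^sub>R L) powr \<delta>)) has_sum
     (L ^ CARD('d) * (s powr (- real CARD('d) / \<delta>) *
        (\<integral>y. cell_profile \<delta> (L * s powr (- 1 / \<delta>)) (y :: real ^ 'd) \<partial>lborel)))) (- {0})"
proof -
  define c where "c = L * s powr (- 1 / \<delta>)"
  have c: "0 < c" using L s by (simp add: c_def)
  have "norm (lattice_point x /\<^sub>R c) powr \<delta> = s * norm (lattice_point x /\<^sub>R L) powr \<delta>" for x :: "int ^ 'd"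
  proof -
    have "inverse c = s powr (1 / \<delta>) * inverse L" using L s by (simp add: c_def powr_minus)
    then have "norm (lattice_point x /\<^sub>R c) = s powr (1 / \<delta>) * norm (lattice_point x /\<^sub>R L)" using L c s by simp
    then show ?thesis using s \<delta> by (simp only:) (subst powr_mult, auto simp: powr_powr)
  qed
  moreover have "c ^ CARD('d) = L ^ CARD('d) * s powr (- real CARD('d) / \<delta>)"
    using s by (simp add: c_def power_mult_distrib powr_realpow[symmetric] powr_powr)
  ultimately show ?thesis using lattice_sum[OF \<delta> c, where 'd = 'd] by (simp add: c_def mult.assoc)
qed

text \<open>
  Away from the origin the potential is at least \<open>L powr (- \<delta>)\<close>, so half of the exponent pays for
  the factor \<open>exp (s * L powr (- \<delta>) / 2)\<close>.
\<close>
lemma lattice_exp_sum_shift: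
  assumes \<delta>: "0 < \<delta>" and L: "0 < L" and s: "0 < s"
    and S: "((\<lambda>x :: int ^ 'd. exp (- s * norm (lattice_point x /\<^sub>R L) powr \<delta>)) has_sum S) (- {0})"
    and T: "((\<lambda>x :: int ^ 'd. exp (- (s / 2) * norm (lattice_point x /\<^sub>R L) powr \<delta>)) has_sum T) (- {0})"
  shows "S * exp (s * (L powr (- \<delta>) / 2)) \<le> T"
proof (rule has_sum_mono[OF has_sum_cmult_left[OF S] T])
  fix x :: "int ^ 'd" assume "x \<in> - {0}"
  then have "1 \<le> norm (lattice_point x)" by (intro norm_lattice_point_ge_1) auto
  then have "inverse L powr \<delta> \<le> norm (lattice_point x /\<^sub>R L) powr \<delta>"
    using L \<delta> by (intro powr_mono2) (auto simp: mult_le_cancel_left1)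
  also have "inverse L powr \<delta> = L powr (- \<delta>)" using L by (simp add: powr_minus inverse_powr)
  finally have "s / 2 * L powr (- \<delta>) \<le> s / 2 * norm (lattice_point x /\<^sub>R L) powr \<delta>"
    using s by (intro mult_left_mono) auto
  then show "exp (- s * norm (lattice_point x /\<^sub>R L) powr \<delta>) * exp (s * (L powr (- \<delta>) / 2))
     \<le> exp (- (s / 2) * norm (lattice_point x /\<^sub>R L) powr \<delta>)"
    unfolding exp_add[symmetric] by simp
qed

lemma infsum_atLeast_1_eq_suminf:
  fixes f g :: "nat \<Rightarrow> real"
  assumes "\<And>j. 1 \<le> j \<Longrightarrow> f j = g j" "g 0 = 0" "\<And>j. 0 \<le> g j" "summable g"
  shows "infsum f {1..} = suminf g"
proof -
  have "infsum f {1..} = infsum g UNIV"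
    by (rule infsum_cong_neutral) (use assms(1,2) in \<open>auto simp: not_le\<close>)
  also have "(g has_sum suminf g) UNIV"
    by (rule sums_nonneg_imp_has_sum) (use assms in auto)
  then have "infsum g UNIV = suminf g" by (rule infsumI)
  finally show ?thesis .
qed

theorem theorem6p3:
  fixes V :: "real ^ 'd \<Rightarrow> real" and \<theta> :: "nat \<Rightarrow> real"
    and \<delta> \<rho> C c a b :: real
    and L :: "nat \<Rightarrow> real" and N :: "nat \<Rightarrow> nat"
  assumes V: "\<And>x. V x = norm x powr \<delta>"
    and \<delta>: "0 < \<delta>" "\<delta> < real CARD('d)"
    and \<theta>_pos: "\<And>j. 1 \<le> j \<Longrightarrow> 0 < \<theta> j"
    and \<theta>_subexp: "(\<lambda>j. 1 / real j * ln (\<theta> j)) \<longlonglongrightarrow> 0"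
    and \<rho>: "rho_c V \<theta> < \<rho>"
    and summable: "(\<lambda>j. real j * \<theta> j / real j powr (real CARD('d) / \<delta>)) summable_on {1..}"
    and C: "0 < C" and c: "0 < c"
    and a: "0 \<le> a" "a < min (1/2) (1 - \<delta> / real CARD('d))"
    and b: "a + max (1/2) (\<delta> / real CARD('d)) < b"
    and h_bounds: "\<And>n :: nat. 1 \<le> n \<Longrightarrow>
          inverse C * exp (- c * real n powr a) \<le> h_coeff \<theta> (int n) \<and>
          h_coeff \<theta> (int n) \<le> C * exp (c * real n powr a)"
    and h_ratio: "(\<lambda>n :: nat. Max {h_coeff \<theta> (int n + m) / h_coeff \<theta> (int n) | m :: int.
          - (real n powr b) \<le> real_of_int m \<and> real_of_int m \<le> real n powr b}) \<longlonglongrightarrow> 1"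
    and L_pos: "\<And>k. 0 < L k"
    and L_lim: "filterlim L at_top sequentially"
    and N_lim: "filterlim N at_top sequentially"
    and N_L: "\<And>k. real (N k) = \<rho> * L k ^ CARD('d)"
  shows "weak_conv_m
    (\<lambda>k. distr (partition_measure V \<theta> (L k) (N k)) borel
       (\<lambda>l. (real (occupation l 0) - L k ^ CARD('d) * (\<rho> - rho_c_L V \<theta> (L k)))
              / (sqrt (sigma_c_sq V \<theta>) * L k powr (real CARD('d) / 2))))
    std_normal_distribution"
proof -
  define d where "d = CARD('d)"
  have d: "0 < d" by (simp add: d_def)
  define p where "p = real d / \<delta>"
  define G where "G = (\<lambda>c. \<integral>y. cell_profile \<delta> c (y :: real ^ 'd) \<partial>lborel)"
  define I1 where "I1 = (\<integral>y. exp (- (norm (y :: real ^ 'd) powr \<delta>)) \<partial>lborel)"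
  define B where "B = (\<integral>y. exp (- ((norm (y :: real ^ 'd) / (1 + real CARD('d))) powr \<delta>)) \<partial>lborel)"
  \<comment> \<open>at \<open>s = 0\<close> this is 0 because \<open>0 powr _ = 0\<close>, which disposes of the index \<open>j = 0\<close>\<close>
  define lam where "lam = (\<lambda>L s. L ^ d * (s powr (- p) * G (L * s powr (- 1 / \<delta>))))"
  define \<phi> where "\<phi> = (\<lambda>k j. \<theta> j * lam (L k) (real j))"
  define M where "M = (\<lambda>j. \<theta> j * ((real j / 2) powr (- p) * B))"
  define m where "m = (\<lambda>j. \<theta> j * (real j powr (- p) * I1))"
  have I1: "0 < I1" unfolding I1_def by (rule integral_exp_powr_pos[OF \<delta>(1)])
  have G: "0 \<le> G c" "G c \<le> B" if "0 < c" for c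
    using cell_profile_integral_bounds[OF \<delta>(1) that, where 'd = 'd] by (auto simp: G_def B_def)
  have B: "0 \<le> B" using G[of 1] by simp
  have lam_sum: "((\<lambda>x :: int ^ 'd. exp (- s * norm (lattice_point x /\<^sub>R L k) powr \<delta>)) has_sum lam (L k) s) (- {0})"
    if "0 < s" for s k
    using lattice_exp_has_sum[OF \<delta>(1) L_pos[of k] that, where 'd = 'd]
    by (simp add: lam_def G_def d_def p_def)
  have lam_V: "((\<lambda>x. exp (- real j * V (lattice_point x /\<^sub>R L k))) has_sum lam (L k) (real j)) (- {0})" if "1 \<le> j" for j k
    using lam_sum[of "real j" k] that by (simp add: V)
  have lam_nn: "0 \<le> lam (L k) s" if "0 < s" for k s
    using has_sum_nonneg[OF lam_sum[OF that]] by simp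
  have \<phi>0: "\<phi> k 0 = 0" for k by (simp add: \<phi>_def lam_def)
  have \<phi>_pos: "0 \<le> \<phi> k j" for k j
    using \<theta>_pos[of j] lam_nn[of "real j" k] by (cases "j = 0") (auto simp: \<phi>0, auto simp: \<phi>_def)
  have Lg: "0 < L k * s powr (- 1 / \<delta>)" if "0 < s" for k s using L_pos[of k] that by simp
  have \<phi>_bound: "\<phi> k j * exp (real j * (L k powr (- \<delta>) / 2)) \<le> L k ^ d * M j" for k j
  proof (cases "j = 0")
    case False
    then have j: "0 < real j" "0 < real j / 2" "1 \<le> j" by auto
    have "lam (L k) (real j) * exp (real j * (L k powr (- \<delta>) / 2)) \<le> lam (L k) (real j / 2)"
      by (rule lattice_exp_sum_shift[OF \<delta>(1) L_pos j(1) lam_sum[OF j(1)] lam_sum[OF j(2)]])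
    also have "\<dots> \<le> L k ^ d * ((real j / 2) powr (- p) * B)"
      unfolding lam_def using L_pos[of k] by (intro mult_left_mono G Lg j) auto
    finally have "\<theta> j * (lam (L k) (real j) * exp (real j * (L k powr (- \<delta>) / 2))) \<le> \<theta> j * (L k ^ d * ((real j / 2) powr (- p) * B))"
      using \<theta>_pos[OF j(3)] by (intro mult_left_mono) auto
    then show ?thesis by (simp add: \<phi>_def M_def mult_ac)
  qed (simp add: \<phi>0 M_def)
  have \<phi>_bound': "\<phi> k j \<le> L k ^ d * M j" for k j
  proof -
    have "\<phi> k j * 1 \<le> \<phi> k j * exp (real j * (L k powr (- \<delta>) / 2))"
      using \<phi>_pos by (intro mult_left_mono) auto
    with \<phi>_bound[of k j] show ?thesis by simp
  qed
  have sum0: "summable (\<lambda>j. real j * \<theta> j / real j powr p)"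
  proof -
    have "(\<lambda>j. real j * \<theta> j / real j powr p) summable_on UNIV \<longleftrightarrow> (\<lambda>j. real j * \<theta> j / real j powr (real CARD('d) / \<delta>)) summable_on {1..}"
      by (rule summable_on_cong_neutral) (auto simp: p_def d_def not_le)
    then show ?thesis using summable by (auto intro: summable_on_imp_summable)
  qed
  have sM: "summable (\<lambda>j. real j * M j)"
  proof -
    have "real j * M j = (2 powr p * B) * (real j * \<theta> j / real j powr p)" for j
      by (simp add: M_def powr_divide powr_minus divide_simps)
    then show ?thesis using summable_mult[OF sum0, of "2 powr p * B"] by simp
  qed
  have sm: "summable (\<lambda>j. real j * m j)"
  proof -
    have "real j * m j = I1 * (real j * \<theta> j / real j powr p)" for j
      by (simp add: m_def powr_minus divide_simps)
    then show ?thesis using summable_mult[OF sum0, of I1] by simp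
  qed
  have m0: "m 0 = 0" by (simp add: m_def)
  have m_pos: "0 < m j" if "1 \<le> j" for j using \<theta>_pos[OF that] I1 that by (simp add: m_def)
  have m_nn: "0 \<le> m j" for j using m_pos[of j] m0 by (cases "j = 0") auto
  have sm1: "summable m"
  proof (rule summable_comparison_test'[OF sm, of 1])
    fix j :: nat assume "1 \<le> j"
    then show "norm (m j) \<le> real j * m j" using m_nn[of j] by (simp add: mult_le_cancel_right1)
  qed
  have int_V: "\<theta> j * (\<integral>x. exp (- real j * V x) \<partial>lborel) = m j" if "1 \<le> j" for j
    using integral_exp_powr_scale[OF \<delta>(1), of "real j", where 'd = 'd] that
    by (simp add: V m_def I1_def p_def d_def)
  have rho_c: "rho_c V \<theta> = suminf m"
    unfolding rho_c_def by (rule infsum_atLeast_1_eq_suminf) (use int_V m0 m_nn sm1 in auto)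
  have sigma: "sigma_c_sq V \<theta> = (\<Sum>j. real j * m j)"
    unfolding sigma_c_sq_def by (rule infsum_atLeast_1_eq_suminf) (use int_V m0 m_nn sm in \<open>auto simp: mult.assoc\<close>)
  have \<sigma>: "0 < (\<Sum>j. real j * m j)"
    by (rule suminf_pos2[OF sm, of 1]) (use m_nn m_pos[of 1] in auto)
  have \<rho>0: "0 < \<rho>" using \<rho> suminf_nonneg[OF sm1 m_nn] unfolding rho_c by linarith
  have v_pos: "0 < L k ^ d" for k using L_pos by simp
  have v_lim: "filterlim (\<lambda>k. L k ^ d) at_top sequentially"
    by (rule filterlim_pow_at_top[OF d L_lim])
  have lim: "(\<lambda>k. \<phi> k j / L k ^ d) \<longlonglongrightarrow> m j" for j
  proof (cases "j = 0")
    case False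
    then have "filterlim (\<lambda>k. L k * real j powr (- 1 / \<delta>)) at_top sequentially"
      by (intro filterlim_at_top_mult_tendsto_pos[OF tendsto_const] L_lim) auto
    from filterlim_compose[OF cell_profile_integral_tendsto[OF \<delta>(1)] this]
    have "(\<lambda>k. G (L k * real j powr (- 1 / \<delta>))) \<longlonglongrightarrow> I1" by (simp add: G_def I1_def)
    then have "(\<lambda>k. \<theta> j * (real j powr (- p) * G (L k * real j powr (- 1 / \<delta>)))) \<longlonglongrightarrow> m j"
      unfolding m_def by (intro tendsto_mult tendsto_const)
    moreover have "\<phi> k j / L k ^ d = \<theta> j * (real j powr (- p) * G (L k * real j powr (- 1 / \<delta>)))" for k
      using v_pos[of k] L_pos[of k] by (simp add: \<phi>_def lam_def)
    ultimately show ?thesis by (simp only:)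
  qed (simp add: \<phi>0 m0)
  have sum\<phi>: "summable (\<phi> k)" for k
    by (rule compound_poisson_exp_moment(3)[where \<phi> = "\<phi> k" and t = 0, OF \<phi>_pos \<phi>0 _ \<phi>_bound sM]) simp
  have rho_c_L: "L k ^ d * rho_c_L V \<theta> (L k) = suminf (\<phi> k)" for k
  proof -
    have "(\<Sum>\<^sub>\<infinity>j\<in>{1..}. \<Sum>\<^sub>\<infinity>x\<in>- {0}. \<theta> j * exp (- real j * V (lattice_point x /\<^sub>R L k))) = suminf (\<phi> k)"
    proof (rule infsum_atLeast_1_eq_suminf)
      fix j :: nat assume "1 \<le> j"
      from infsumI[OF has_sum_cmult_right[OF lam_V[OF this], of "\<theta> j"]]
      show "(\<Sum>\<^sub>\<infinity>x\<in>- {0}. \<theta> j * exp (- real j * V (lattice_point x /\<^sub>R L k))) = \<phi> k j"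
        by (simp add: \<phi>_def)
    qed (use \<phi>0 \<phi>_pos sum\<phi> in auto)
    then show ?thesis using L_pos[of k] by (simp add: rho_c_L_def d_def)
  qed
  have mean: "(\<lambda>k. suminf (\<phi> k) / L k ^ d) \<longlonglongrightarrow> suminf m"
    by (rule compound_poisson_mean_tendsto[OF \<phi>_pos \<phi>0 v_pos \<phi>_bound' sM lim])
  have a': "a + max (1/2) (\<delta> / real d) < 1" using a(2) by (auto simp: d_def max_def min_def split: if_splits)
  define h where "h = h_coeff \<theta>"
  define n0 where "n0 = (\<lambda>k. int (N k) - \<lfloor>suminf (\<phi> k)\<rfloor>)"
  define g where "g = (\<lambda>k i. h (int (N k) - int i) / h (n0 k))"
  define P where "P = (\<lambda>k. compound_poisson (\<phi> k))"
  note tilt_rule = tilt_negligible[where h = "h_coeff \<theta>" and \<phi> = \<phi> and L = L and N = N and d = d,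
    OF d \<delta>(1) \<rho>[unfolded rho_c] \<rho>0 C c a(1) a' b[folded d_def] h_coeff_neg h_coeff_0 h_bounds h_ratio L_pos L_lim
      N_L[folded d_def] \<phi>_pos \<phi>0 \<phi>_bound sM mean]
  have tilt: "\<forall>\<^sub>F k in sequentially. summable (\<lambda>i. \<bar>g k i - 1\<bar> * P k i)"
      "(\<lambda>k. \<Sum>i. \<bar>g k i - 1\<bar> * P k i) \<longlonglongrightarrow> 0"
      "\<forall>\<^sub>F k in sequentially. 0 < h (n0 k)"
    unfolding g_def P_def h_def n0_def by (rule tilt_rule; assumption)+
  have P: "0 \<le> P k i" "P k sums 1" for k i
    unfolding P_def using compound_poisson_nonneg[of "\<phi> k"] compound_poisson_sums[of "\<phi> k"] \<phi>_pos \<phi>0 sum\<phi> by auto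
  have \<theta>_nn: "\<And>j. 1 \<le> j \<Longrightarrow> 0 \<le> \<theta> j" using \<theta>_pos by (simp add: less_imp_le)
  have V0: "V 0 = 0" using \<delta> by (simp add: V)
  define h' where "h' = (\<lambda>k. h_coeff (\<phi> k))"
  have h'_eq: "h_coeff (\<lambda>j. \<theta> j * lam (L k) (real j)) = h' k" for k by (simp add: h'_def \<phi>_def)
  have h'_nn: "0 \<le> h' k i" for k i unfolding h'_def by (rule h_coeff_nonneg) (rule \<phi>_pos)
  have h_nn: "0 \<le> h i" for i unfolding h_def by (rule h_coeff_nonneg) (rule \<theta>_nn)
  have h_pos: "0 < h (int n)" for n
  proof (cases "n = 0")
    case False
    have "0 < inverse C * exp (- c * real n powr a)" using C by simp
    then show ?thesis using h_bounds[of n] False unfolding h_def by linarith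
  qed (simp add: h_def)
  define Z where "Z = (\<lambda>k. partition_function V \<theta> (L k) (N k))"
  have Z_eq: "Z k = (\<Sum>i\<le>N k. h (int i) * h' k (int (N k - i)))" for k
    unfolding Z_def using partition_function_eq[where \<theta> = \<theta>, OF \<theta>_nn V0 lam_V] by (simp only: h'_eq h_def)
  have Z_pos: "0 < Z k" for k
  proof -
    have "0 < h (int (N k)) * h' k (int (N k - N k))" using h_pos by (simp add: h'_def)
    also have "\<dots> \<le> Z k" unfolding Z_eq
      by (rule member_le_sum[of "N k" "{..N k}" "\<lambda>i. h (int i) * h' k (int (N k - i))"]) (use h_nn h'_nn in auto)
    finally show ?thesis .
  qed
  define X where "X = (\<lambda>k (l :: int ^ 'd \<Rightarrow> nat multiset). (real (occupation l 0) - L k ^ CARD('d) * (\<rho> - rho_c_L V \<theta> (L k)))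
              / (sqrt (sigma_c_sq V \<theta>) * L k powr (real CARD('d) / 2)))"
  define s where "s = (\<lambda>k. sqrt ((\<Sum>j. real j * m j) * L k ^ d))"
  have X_eq: "X k l = (real (occupation l 0) - (real (N k) - suminf (\<phi> k))) / s k" for k l
  proof -
    have "L k ^ d * (\<rho> - rho_c_L V \<theta> (L k)) = real (N k) - suminf (\<phi> k)"
      using rho_c_L[of k] N_L[of k] by (simp add: d_def algebra_simps)
    moreover have "sqrt (L k ^ d) = L k powr (real d / 2)"
      using L_pos[of k] by (simp add: powr_half_sqrt[symmetric] powr_realpow[symmetric] powr_powr)
    ultimately show ?thesis
      unfolding X_def s_def by (simp add: d_def sigma real_sqrt_mult)
  qed
  have prob: "prob_space (partition_measure V \<theta> (L k) (N k))" for k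
    by (rule partition_measure_occupation(1)[OF \<theta>_nn V0 lam_V Z_pos[unfolded Z_def]])
  have X_meas: "X k \<in> borel_measurable (partition_measure V \<theta> (L k) (N k))" for k
    by (simp add: partition_measure_def)
  have rd: "real_distribution (distr (partition_measure V \<theta> (L k) (N k)) borel (X k))" for k
    by (rule prob_space.real_distribution_distr[OF prob X_meas])
  have char_eq: "\<forall>\<^sub>F k in sequentially. (\<Sum>i. of_real (g k i * P k i) * iexp (- t / s k * (real i - suminf (\<phi> k)))) / of_real (\<Sum>i. g k i * P k i)
     = char (distr (partition_measure V \<theta> (L k) (N k)) borel (X k)) t" for t
    using tilt(3)
  proof eventually_elim
    case (elim k)
    let ?n = "N k" and ?\<mu> = "suminf (\<phi> k)"
    define F where "F = (\<lambda>i :: nat. iexp (t * ((real i - (real ?n - ?\<mu>)) / s k)))"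
    define f where "f = (\<lambda>i :: nat. iexp (- t / s k * (real i - ?\<mu>)))"
    \<comment> \<open>a factor common to numerator and denominator, turning \<open>h_coeff\<close> into the compound Poisson law and the tilt into \<open>g\<close>\<close>
    define \<gamma> where "\<gamma> = exp (- (\<Sum>j. \<phi> k j / real j)) / h (n0 k)"
    have \<gamma>: "0 < \<gamma>" using elim by (simp add: \<gamma>_def)
    have gP: "g k i * P k i = \<gamma> * (h (int ?n - int i) * h' k (int i))" for i
      by (simp add: g_def P_def compound_poisson_def h'_def \<gamma>_def)
    have gP0: "g k i * P k i = 0" if "i \<notin> {..?n}" for i
      using that by (simp add: gP h_def)
    have gPf0: "of_real (g k i * P k i) * f i = 0" if "i \<notin> {..?n}" for i
      by (simp only: gP0[OF that] of_real_0 mult_zero_left)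
    have Ff: "F (?n - i) = f i" if "i \<le> ?n" for i
    proof -
      have "t * ((real (?n - i) - (real ?n - ?\<mu>)) / s k) = - t / s k * (real i - ?\<mu>)"
        using that by (simp add: of_nat_diff right_diff_distrib diff_divide_distrib)
      then show ?thesis by (simp only: F_def f_def)
    qed
    have "char (distr (partition_measure V \<theta> (L k) ?n) borel (X k)) t = (\<integral>l. F (occupation l 0) \<partial>partition_measure V \<theta> (L k) ?n)"
      unfolding char_def by (subst integral_distr[OF X_meas]) (auto simp: X_eq F_def)
    also have "\<dots> = (\<Sum>i\<le>?n. F i * of_real (h (int i) * h' k (int (?n - i)))) / of_real (Z k)"
      using partition_measure_occupation(2)[where F = F, OF \<theta>_nn V0 lam_V Z_pos[unfolded Z_def]]
      by (simp only: h'_eq h_def Z_def)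
    also have "(\<Sum>i\<le>?n. F i * of_real (h (int i) * h' k (int (?n - i)))) = (\<Sum>i\<le>?n. f i * of_real (h (int ?n - int i) * h' k (int i)))"
      by (rule sum.reindex_bij_witness[of _ "\<lambda>i. ?n - i" "\<lambda>i. ?n - i"]) (auto simp: Ff[symmetric] of_nat_diff)
    also have "Z k = (\<Sum>i\<le>?n. h (int ?n - int i) * h' k (int i))"
      unfolding Z_eq by (rule sum.reindex_bij_witness[of _ "\<lambda>i. ?n - i" "\<lambda>i. ?n - i"]) (auto simp: of_nat_diff)
    also have "(\<Sum>i\<le>?n. f i * of_real (h (int ?n - int i) * h' k (int i))) / of_real (\<Sum>i\<le>?n. h (int ?n - int i) * h' k (int i))
       = (of_real \<gamma> * (\<Sum>i\<le>?n. f i * of_real (h (int ?n - int i) * h' k (int i)))) / (of_real \<gamma> * of_real (\<Sum>i\<le>?n. h (int ?n - int i) * h' k (int i)))"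
      using \<gamma> by (subst mult_divide_mult_cancel_left) auto
    also have "of_real \<gamma> * of_real (\<Sum>i\<le>?n. h (int ?n - int i) * h' k (int i)) = complex_of_real (\<Sum>i. g k i * P k i)"
      by (subst suminf_finite[of "{..?n}", OF _ gP0]) (auto simp: gP sum_distrib_left)
    also have "of_real \<gamma> * (\<Sum>i\<le>?n. f i * of_real (h (int ?n - int i) * h' k (int i))) = (\<Sum>i. of_real (g k i * P k i) * f i)"
      by (subst suminf_finite[of "{..?n}", OF _ gPf0]) (simp, simp, simp only: gP, simp add: sum_distrib_left mult_ac)
    finally show ?case by (simp add: f_def)
  qed
  have "weak_conv_m (\<lambda>k. distr (partition_measure V \<theta> (L k) (N k)) borel (X k)) std_normal_distribution"
  proof (rule levy_continuity[OF rd real_dist_normal_dist])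
    fix t :: real
    \<comment> \<open>the occupation is \<open>N k - K\<close>, whence the argument \<open>- t\<close> for the law of \<open>K\<close>\<close>
    have clt: "(\<lambda>k. \<Sum>i. of_real (P k i) * iexp (- t / s k * (real i - suminf (\<phi> k)))) \<longlonglongrightarrow> of_real (exp (- ((- t)\<^sup>2 / 2)))"
      unfolding P_def s_def by (rule compound_poisson_clt[OF \<phi>_pos \<phi>0 v_pos v_lim \<phi>_bound' sM lim \<sigma>])
    have "(\<lambda>k. (\<Sum>i. of_real (g k i * P k i) * iexp (- t / s k * (real i - suminf (\<phi> k)))) / of_real (\<Sum>i. g k i * P k i)) \<longlonglongrightarrow> of_real (exp (- ((- t)\<^sup>2 / 2)))"
      by (rule tilted_average_tendsto[OF P _ _ _ clt]) (use tilt(1,2) in auto)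
    then have "(\<lambda>k. char (distr (partition_measure V \<theta> (L k) (N k)) borel (X k)) t) \<longlonglongrightarrow> of_real (exp (- ((- t)\<^sup>2 / 2)))"
      by (rule Lim_transform_eventually[OF _ char_eq])
    then show "(\<lambda>k. char (distr (partition_measure V \<theta> (L k) (N k)) borel (X k)) t) \<longlonglongrightarrow> char std_normal_distribution t"
      by (simp add: char_std_normal_distribution)
  qed
  then show ?thesis unfolding X_def .
qed

end
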